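(* Let $(\mathbf{X},\mathbf{T})$ be a nonautonomous dynamical system, let $K\subset X_0$ be non-empty and compact, and let $\mathbf{f}\in\mathbf{C}(\mathbf{X},\mathbb{R})$ be equicontinuous. Then $$P^{\mathrm{B}}(\mathbf{T},\mathbf{f},K)=\sup\{\underline{P}_{\mu}(\mathbf{T},\mathbf{f}):\mu\in M(X_0),\ \mu(K)=1\}.$$
   Context: A nonautonomous dynamical system (NDS) $(\mathbf{X},\mathbf{T})$ consists of a sequence $\mathbf{X}=\{X_k\}_{k=0}^\infty$ of compact metric spaces $(X_k,d_k)$ and a sequence $\mathbf{T}=\{T_k\}_{k=0}^\infty$ of continuous maps $T_k:X_k\to X_{k+1}$. Put $\mathbf{T}^0=\mathrm{id}_{X_0}$ and $\mathbf{T}^j=T_{j-1}\circ\cdots\circ T_0:X_0\to X_j$. For $n\ge1$ and $x,y\in X_0$ let $d_n^{\mathbf{T}}(x,y)=\max_{0\le j\le n-1}d_j(\mathbf{T}^jx,\mathbf{T}^jy)$, and for $\varepsilon>0$ let $B_n^{\mathbf{T}}(x,\varepsilon)=\{y\in X_0:d_n^{\mathbf{T}}(x,y)<\varepsilon\}$ (Bowen ball). $M(X_0)$ is the set of Borel probability measures on $X_0$. $\mathbf{C}(\mathbf{X},\mathbb{R})=\prod_{k\ge0}C(X_k,\mathbb{R})$ is the set of sequences $\mathbf{f}=\{f_k\}_{k=0}^\infty$ of continuous functions $f_k:X_k\to\mathbb{R}$. $\mathbf{f}$ is equicontinuous if for every $\varepsilon>0$ there is $\delta>0$ such that for all $k\ge0$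 and all $x',x''\in X_k$ with $d_k(x',x'')<\delta$ one has $|f_k(x')-f_k(x'')|<\varepsilon$. Put $S_n^{\mathbf{T}}\mathbf{f}=\sum_{j=0}^{n-1}f_j\circ\mathbf{T}^j$. Measure-theoretic lower local pressure: $\underline{P}_\mu(\mathbf{T},\mathbf{f},x)=\lim_{\varepsilon\to0}\liminf_{n\to\infty}\frac{-\log\mu(B_n^{\mathbf{T}}(x,\varepsilon))+S_n^{\mathbf{T}}\mathbf{f}(x)}{n}\in\mathbb{R}\cup\{\pm\infty\}$, with $\log0=-\infty$ (the inner quantity is non-increasing in $\varepsilon$). Measure-theoretic lower pressure: $\underline{P}_\mu(\mathbf{T},\mathbf{f})=\int_{X_0}\underline{P}_\mu(\mathbf{T},\mathbf{f},x)\,d\mu(x)$. Bowen pressure: for $Z\subset X_0$, an $(N,\varepsilon)$-cover of $Z$ is a family $\{B_{n_i}^{\mathbf{T}}(x_i,\varepsilon)\}_i$ with $x_i\in X_0$ and integers $n_i\ge N$ whose union contains $Z$. For $s\in\mathbb{R}$, $N>0$, $\varepsilon>0$ let $\mathscr{R}_{N,\varepsilon}^{s}(\mathbf{T},\mathbf{f},Z)=\inf\sum_i\exp(-n_is+S_{n_i}^{\mathbf{T}}\mathbf{f}(x_i))$, the infimum over all countable (finite or infinite) $(N,\varepsilon)$-covers of $Z$. Let $\mathscr{R}_{\varepsilon}^{s}(\mathbf{T},\mathbf{f},Z)=\lim_{N\to\infty}\mathscr{R}_{N,\varepsilon}^{s}(\mathbf{T},\mathbf{f},Z)$ and $P^{\mathrm{B}}(\mathbf{T},\mathbf{f},Z,\varepsilon)=\inf\{s:\mathscr{R}_{\varepsilon}^{s}(\mathbf{T},\mathbf{f},Z)=0\}=\sup\{s:\mathscr{R}_{\varepsilon}^{s}(\mathbf{T},\mathbf{f},Z)=+\infty\}$.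 Then $P^{\mathrm{B}}(\mathbf{T},\mathbf{f},Z)=\lim_{\varepsilon\to0}P^{\mathrm{B}}(\mathbf{T},\mathbf{f},Z,\varepsilon)$ (monotone limit). *)

theory Defs
  imports "HOL-Probability.Probability"
begin

section \<open>Nonautonomous dynamical systems\<close>

text \<open>
  The spaces of the sequence may be pairwise unrelated, so each one is a value of the library type
  of bundled metric spaces, with its own carrier and its own metric. Sharing the element type
  \<open>'a\<close> is no restriction: any sequence of metric spaces can be realised on the disjoint
  union of its carriers. The maps and functions are total on \<open>'a\<close>, and their
  values outside the carriers are never used.
\<close>

locale nds =
  fixes X :: "nat \<Rightarrow> 'a metric"
    and T :: "nat \<Rightarrow> 'a \<Rightarrow> 'a"
  assumes compact_spaces: "\<And>k. compact_space (mtopology_of (X k))"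
    and continuous_maps: "\<And>k. continuous_map (mtopology_of (X k)) (mtopology_of (X (Suc k))) (T k)"

primrec iter :: "(nat \<Rightarrow> 'a \<Rightarrow> 'a) \<Rightarrow> nat \<Rightarrow> 'a \<Rightarrow> 'a" where
  "iter T 0 = id"
| "iter T (Suc j) = T j \<circ> iter T j"

text \<open>Only meaningful for \<open>n \<ge> 1\<close> (the maximum is over an empty set when \<open>n = 0\<close>).\<close>

definition bowen_dist ::
  "(nat \<Rightarrow> 'a metric) \<Rightarrow> (nat \<Rightarrow> 'a \<Rightarrow> 'a) \<Rightarrow> nat \<Rightarrow> 'a \<Rightarrow> 'a \<Rightarrow> real" where
  "bowen_dist X T n x y = (MAX j\<in>{..<n}. mdist (X j) (iter T j x) (iter T j y))"

definition bowen_ball ::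
  "(nat \<Rightarrow> 'a metric) \<Rightarrow> (nat \<Rightarrow> 'a \<Rightarrow> 'a) \<Rightarrow> nat \<Rightarrow> 'a \<Rightarrow> real \<Rightarrow> 'a set" where
  "bowen_ball X T n x \<epsilon> = {y \<in> mspace (X 0). bowen_dist X T n x y < \<epsilon>}"

definition continuous_functions ::
  "(nat \<Rightarrow> 'a metric) \<Rightarrow> (nat \<Rightarrow> 'a \<Rightarrow> real) set" where
  "continuous_functions X = {f. \<forall>k. continuous_map (mtopology_of (X k)) euclideanreal (f k)}"

definition equicontinuous ::
  "(nat \<Rightarrow> 'a metric) \<Rightarrow> (nat \<Rightarrow> 'a \<Rightarrow> real) \<Rightarrow> bool" where
  "equicontinuous X f \<longleftrightarrow>
    (\<forall>\<epsilon>>0. \<exists>\<delta>>0. \<forall>k. \<forall>x\<in>mspace (X k). \<forall>y\<in>mspace (X k).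
       mdist (X k) x y < \<delta> \<longrightarrow> \<bar>f k x - f k y\<bar> < \<epsilon>)"

definition birkhoff_sum ::
  "(nat \<Rightarrow> 'a \<Rightarrow> 'a) \<Rightarrow> (nat \<Rightarrow> 'a \<Rightarrow> real) \<Rightarrow> nat \<Rightarrow> 'a \<Rightarrow> real" where
  "birkhoff_sum T f n x = (\<Sum>j<n. f j (iter T j x))"

section \<open>Measure-theoretic lower pressure\<close>

definition borel_prob_measures :: "'a metric \<Rightarrow> 'a measure set" where
  "borel_prob_measures m =
    {\<mu>. prob_space \<mu> \<and> space \<mu> = mspace m \<and>
        sets \<mu> = sigma_sets (mspace m) {U. openin (mtopology_of m) U}}"

definition neg_log_measure :: "'a measure \<Rightarrow> 'a set \<Rightarrow> ereal" where
  "neg_log_measure \<mu> A = (if measure \<mu> A = 0 then \<infinity> else ereal (- ln (measure \<mu> A)))"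

definition lower_local_pressure ::
  "(nat \<Rightarrow> 'a metric) \<Rightarrow> (nat \<Rightarrow> 'a \<Rightarrow> 'a) \<Rightarrow> (nat \<Rightarrow> 'a \<Rightarrow> real) \<Rightarrow> 'a measure \<Rightarrow> 'a \<Rightarrow> ereal" where
  "lower_local_pressure X T f \<mu> x =
    Lim (at_right 0) (\<lambda>\<epsilon>. liminf (\<lambda>n.
      (neg_log_measure \<mu> (bowen_ball X T n x \<epsilon>) + ereal (birkhoff_sum T f n x)) / ereal (real n)))"

text \<open>
  The Lebesgue integral of an extended-real function, as the integral of the positive part minus
  the integral of the negative part; \<open>e2ennreal\<close> sends negative numbers to 0. Since the functions
  \<open>f k\<close> need not be uniformly bounded, both parts of the local pressure may have infinite integral.
  Such an undefined integral gets the value \<open>-\<infinity>\<close>, so that it contributes nothing to a supremum.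
\<close>

definition ereal_integral :: "'a measure \<Rightarrow> ('a \<Rightarrow> ereal) \<Rightarrow> ereal" where
  "ereal_integral \<mu> g =
    (let p = \<integral>\<^sup>+ x. e2ennreal (g x) \<partial>\<mu>; q = \<integral>\<^sup>+ x. e2ennreal (- g x) \<partial>\<mu>
     in if p = \<infinity> \<and> q = \<infinity> then - \<infinity> else enn2ereal p - enn2ereal q)"

definition lower_pressure ::
  "(nat \<Rightarrow> 'a metric) \<Rightarrow> (nat \<Rightarrow> 'a \<Rightarrow> 'a) \<Rightarrow> (nat \<Rightarrow> 'a \<Rightarrow> real) \<Rightarrow> 'a measure \<Rightarrow> ereal" where
  "lower_pressure X T f \<mu> = ereal_integral \<mu> (lower_local_pressure X T f \<mu>)"

section \<open>Bowen pressure\<close>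

text \<open>
  A countable (finite or infinite) cover is indexed by an arbitrary set \<open>I\<close> of natural numbers:
  the triple \<open>(I, n, x)\<close> stands for the family of Bowen balls of order \<open>n i\<close> at \<open>x i\<close>, \<open>i \<in> I\<close>.
\<close>

definition bowen_covers ::
  "(nat \<Rightarrow> 'a metric) \<Rightarrow> (nat \<Rightarrow> 'a \<Rightarrow> 'a) \<Rightarrow> nat \<Rightarrow> real \<Rightarrow> 'a set
    \<Rightarrow> (nat set \<times> (nat \<Rightarrow> nat) \<times> (nat \<Rightarrow> 'a)) set" where
  "bowen_covers X T N \<epsilon> Z =
    {(I, n, x). (\<forall>i\<in>I. x i \<in> mspace (X 0) \<and> N \<le> n i) \<and> Z \<subseteq> (\<Union>i\<in>I. bowen_ball X T (n i) (x i) \<epsilon>)}"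

definition bowen_sum_inf ::
  "(nat \<Rightarrow> 'a metric) \<Rightarrow> (nat \<Rightarrow> 'a \<Rightarrow> 'a) \<Rightarrow> (nat \<Rightarrow> 'a \<Rightarrow> real) \<Rightarrow> real \<Rightarrow> nat \<Rightarrow> real \<Rightarrow> 'a set
    \<Rightarrow> ennreal" where
  "bowen_sum_inf X T f s N \<epsilon> Z =
    (INF (I, n, x)\<in>bowen_covers X T N \<epsilon> Z.
       \<Sum>\<^sub>\<infinity>i\<in>I. ennreal (exp (- real (n i) * s + birkhoff_sum T f (n i) (x i))))"

definition bowen_sum_lim ::
  "(nat \<Rightarrow> 'a metric) \<Rightarrow> (nat \<Rightarrow> 'a \<Rightarrow> 'a) \<Rightarrow> (nat \<Rightarrow> 'a \<Rightarrow> real) \<Rightarrow> real \<Rightarrow> real \<Rightarrow> 'a set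
    \<Rightarrow> ennreal" where
  "bowen_sum_lim X T f s \<epsilon> Z = lim (\<lambda>N. bowen_sum_inf X T f s N \<epsilon> Z)"

definition bowen_pressure_at ::
  "(nat \<Rightarrow> 'a metric) \<Rightarrow> (nat \<Rightarrow> 'a \<Rightarrow> 'a) \<Rightarrow> (nat \<Rightarrow> 'a \<Rightarrow> real) \<Rightarrow> 'a set \<Rightarrow> real \<Rightarrow> ereal" where
  "bowen_pressure_at X T f Z \<epsilon> = Inf {ereal s |s. bowen_sum_lim X T f s \<epsilon> Z = 0}"

definition bowen_pressure ::
  "(nat \<Rightarrow> 'a metric) \<Rightarrow> (nat \<Rightarrow> 'a \<Rightarrow> 'a) \<Rightarrow> (nat \<Rightarrow> 'a \<Rightarrow> real) \<Rightarrow> 'a set \<Rightarrow> ereal" where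
  "bowen_pressure X T f Z = Lim (at_right 0) (bowen_pressure_at X T f Z)"

end

theory Submission
  imports Defs
begin

text \<open>
  A measure whose local pressure exceeds \<open>s\<close> on a non-null set gives that set no mass through cheap
  covers, because the Bowen balls meeting the set have small measure; so the pressure of \<open>K\<close> is at
  least \<open>s\<close>, up to the variation of Birkhoff sums on small Bowen balls.

  Conversely, let \<open>s\<close> be smaller than the pressure of \<open>K\<close>. Minimax duality over the compact convex set
  of finitely additive probabilities on \<open>K\<close> yields either one that gives every Bowen ball of large
  order \<open>n\<close> mass at most a constant times \<open>exp (S\<^sub>n f - n s)\<close>, or a cheap weighted cover of \<open>K\<close> by
  Bowen balls. A cheap weighted cover can be turned into a cheap cover by balls of twice the radius,
  centred at separated points, which contradicts the choice of \<open>s\<close>. Outer regularisation makes the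
  finitely additive probability a Borel measure without increasing the mass of the (open) balls.
\<close>

section \<open>Finitely additive probabilities and their regularisation\<close>

text \<open>Charges are defined on all subsets and are only finitely additive, so each defining
  condition is closed under pointwise convergence and Dirac masses qualify; this gives a compact
  convex set for the duality argument. The complement in \<open>m (- K) = 0\<close> is taken in the
  whole type.\<close>

definition prob_charges :: "'a set \<Rightarrow> ('a set \<Rightarrow> real) set" where
  "prob_charges K = {m. (\<forall>A. 0 \<le> m A) \<and> (\<forall>A B. A \<inter> B = {} \<longrightarrow> m (A \<union> B) = m A + m B) \<and>
     m K = 1 \<and> m (- K) = 0}"

lemma prob_charges_nonneg: "m \<in> prob_charges K \<Longrightarrow> 0 \<le> m A"
  by (simp add: prob_charges_def)

lemma prob_charges_Un: "m \<in> prob_charges K \<Longrightarrow> A \<inter> B = {} \<Longrightarrow> m (A \<union> B) = m A + m B"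
  by (simp add: prob_charges_def)

lemma prob_charges_empty: "m \<in> prob_charges K \<Longrightarrow> m {} = 0"
  using prob_charges_Un[of m K "{}" "{}"] by simp

lemma prob_charges_mono:
  assumes "m \<in> prob_charges K" "A \<subseteq> B" shows "m A \<le> m B"
proof -
  have "m B = m A + m (B - A)"
    using prob_charges_Un[OF assms(1), of A "B - A"] assms(2) by (simp add: Un_absorb1)
  then show ?thesis
    using prob_charges_nonneg[OF assms(1), of "B - A"] by simp
qed

lemma prob_charges_subadditive:
  assumes "m \<in> prob_charges K" shows "m (A \<union> B) \<le> m A + m B"
proof -
  have "m (A \<union> B) = m A + m (B - A)"
    using prob_charges_Un[OF assms(1), of A "B - A"] by simp
  then show ?thesis
    using prob_charges_mono[OF assms(1), of "B - A" B] by auto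
qed

lemma prob_charges_superset:
  assumes "m \<in> prob_charges K" "K \<subseteq> A" shows "m A = 1"
proof (rule antisym)
  have "m A \<le> m (K \<union> - K)"
    by (rule prob_charges_mono[OF assms(1)]) auto
  also have "\<dots> = 1"
    using assms(1) prob_charges_Un[OF assms(1), of K "- K"] by (simp add: prob_charges_def)
  finally show "m A \<le> 1" .
  show "1 \<le> m A"
    using prob_charges_mono[OF assms] assms(1) by (simp add: prob_charges_def)
qed

text \<open>The closure condition leaves room around \<open>G\<close>: in a compact normal space its
  closure is compact and can be separated from closed sets by open ones, and both facts feed
  subadditivity. The value on an open set \<open>W\<close> may drop below \<open>m W\<close>, which
  is harmless because only upper bounds for balls are wanted.\<close>

definition inner_content :: "'a topology \<Rightarrow> ('a set \<Rightarrow> real) \<Rightarrow> 'a set \<Rightarrow> ennreal" where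
  "inner_content Y m W = (SUP G\<in>{G. openin Y G \<and> Y closure_of G \<subseteq> W}. ennreal (m G))"

definition outer_content :: "'a topology \<Rightarrow> ('a set \<Rightarrow> real) \<Rightarrow> 'a set \<Rightarrow> ennreal" where
  "outer_content Y m A = (INF W\<in>{W. openin Y W \<and> A \<subseteq> W}. inner_content Y m W)"

lemma inner_content_upper:
  "openin Y G \<Longrightarrow> Y closure_of G \<subseteq> W \<Longrightarrow> ennreal (m G) \<le> inner_content Y m W"
  unfolding inner_content_def by (rule SUP_upper) auto

lemma inner_content_mono: "V \<subseteq> W \<Longrightarrow> inner_content Y m V \<le> inner_content Y m W"
  unfolding inner_content_def by (rule SUP_subset_mono) auto

lemma inner_content_le:
  assumes m: "m \<in> prob_charges K"
  shows "inner_content Y m W \<le> ennreal (m W)"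
  unfolding inner_content_def
proof (rule SUP_least)
  fix G assume "G \<in> {G. openin Y G \<and> Y closure_of G \<subseteq> W}"
  then have "G \<subseteq> W"
    using closure_of_subset[of G Y] openin_subset[of Y G] by auto
  then show "ennreal (m G) \<le> ennreal (m W)"
    by (intro ennreal_leI prob_charges_mono[OF m])
qed

lemma inner_content_empty: "m \<in> prob_charges K \<Longrightarrow> inner_content Y m {} = 0"
  using inner_content_le[of m K Y "{}"] by (simp add: prob_charges_empty)

text \<open>The union of \<open>G\<close> with a set \<open>H\<close> admissible for
  \<open>W\<close> is admissible for \<open>V\<close>, since closure commutes with finite unions,
  and \<open>m\<close> is additive on the disjoint pair. This is the superadditive half of the
  measurability of open sets.\<close>

lemma inner_content_disjoint_le:
  assumes m: "m \<in> prob_charges K"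
    and G: "openin Y G" "Y closure_of G \<subseteq> V" and W: "W \<subseteq> V" "G \<inter> W = {}"
  shows "ennreal (m G) + inner_content Y m W \<le> inner_content Y m V"
proof -
  have ne: "{H. openin Y H \<and> Y closure_of H \<subseteq> W} \<noteq> {}"
    by (auto intro!: exI[of _ "{}"])
  show ?thesis
    unfolding inner_content_def[of Y m W] ennreal_SUP_add_right[OF ne]
  proof (rule SUP_least)
    fix H assume "H \<in> {H. openin Y H \<and> Y closure_of H \<subseteq> W}"
    then have H: "openin Y H" "Y closure_of H \<subseteq> W" by auto
    then have "H \<subseteq> W"
      using closure_of_subset[of H Y] openin_subset[of Y H] by auto
    then have "G \<inter> H = {}" using W by auto
    then have "ennreal (m G) + ennreal (m H) = ennreal (m (G \<union> H))"
      by (simp add: prob_charges_Un[OF m] prob_charges_nonneg[OF m] ennreal_plus)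
    also have "\<dots> \<le> inner_content Y m V"
      using G H W by (intro inner_content_upper) (auto simp: closure_of_Un)
    finally show "ennreal (m G) + ennreal (m H) \<le> inner_content Y m V" .
  qed
qed

text \<open>Normality splits an admissible \<open>G\<close>: the part of its closure outside
  \<open>W\<close> is wrapped in an open \<open>G1\<close> with closure inside \<open>V\<close>, and
  what is left outside \<open>G1\<close> in an open \<open>G2\<close> with closure inside
  \<open>W\<close>.\<close>

lemma inner_content_Un_le:
  assumes m: "m \<in> prob_charges K" and Y: "normal_space Y"
    and V: "openin Y V" and W: "openin Y W"
  shows "inner_content Y m (V \<union> W) \<le> inner_content Y m V + inner_content Y m W"
  unfolding inner_content_def[of Y m "V \<union> W"]
proof (rule SUP_least)
  fix G assume "G \<in> {G. openin Y G \<and> Y closure_of G \<subseteq> V \<union> W}"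
  then have G: "openin Y G" "Y closure_of G \<subseteq> V \<union> W" by auto
  have alt: "\<exists>U. openin Y U \<and> C \<subseteq> U \<and> Y closure_of U \<subseteq> D" if "closedin Y C" "openin Y D" "C \<subseteq> D" for C D
    using Y that unfolding normal_space_alt by blast
  obtain G1 where G1: "openin Y G1" "Y closure_of G - W \<subseteq> G1" "Y closure_of G1 \<subseteq> V"
    using alt[of "Y closure_of G - W" V] G V W closedin_diff[OF closedin_closure_of W, of G] by blast
  obtain G2 where G2: "openin Y G2" "Y closure_of G - G1 \<subseteq> G2" "Y closure_of G2 \<subseteq> W"
    using alt[of "Y closure_of G - G1" W] G G1 W closedin_diff[OF closedin_closure_of G1(1), of G] by blast
  have "G \<subseteq> Y closure_of G"
    using G by (simp add: closure_of_subset openin_subset)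
  then have "G \<subseteq> G1 \<union> G2" using G2(2) by blast
  then have "m G \<le> m G1 + m G2"
    using prob_charges_mono[OF m] prob_charges_subadditive[OF m] order_trans by blast
  then have "ennreal (m G) \<le> ennreal (m G1) + ennreal (m G2)"
    by (simp add: prob_charges_nonneg[OF m] flip: ennreal_plus)
  also have "\<dots> \<le> inner_content Y m V + inner_content Y m W"
    using G1 G2 by (intro add_mono inner_content_upper)
  finally show "ennreal (m G) \<le> inner_content Y m V + inner_content Y m W" .
qed

lemma inner_content_finite_UN_le:
  fixes W :: "nat \<Rightarrow> 'a set"
  assumes m: "m \<in> prob_charges K" and Y: "normal_space Y" and W: "\<And>i. openin Y (W i)"
  shows "inner_content Y m (\<Union>i<n. W i) \<le> (\<Sum>i<n. inner_content Y m (W i))"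
proof (induction n)
  case 0
  then show ?case by (simp add: inner_content_empty[OF m])
next
  case (Suc n)
  have "inner_content Y m (\<Union>i<Suc n. W i) \<le> inner_content Y m (\<Union>i<n. W i) + inner_content Y m (W n)"
    using inner_content_Un_le[OF m Y, of "\<Union>i<n. W i" "W n"] W
    by (auto simp: lessThan_Suc Un_commute)
  then show ?case using Suc by (auto intro: order_trans add_right_mono)
qed

text \<open>The closure of an admissible \<open>G\<close> is compact, so finitely many of the
  \<open>W i\<close> already contain it. Countable subadditivity thus arises from a merely finitely
  additive \<open>m\<close>.\<close>

lemma inner_content_UN_le:
  fixes W :: "nat \<Rightarrow> 'a set"
  assumes m: "m \<in> prob_charges K" and Y: "normal_space Y" "compact_space Y"
    and W: "\<And>i. openin Y (W i)"
  shows "inner_content Y m (\<Union>i. W i) \<le> (\<Sum>i. inner_content Y m (W i))"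
  unfolding inner_content_def[of Y m "\<Union>i. W i"]
proof (rule SUP_least)
  fix G assume "G \<in> {G. openin Y G \<and> Y closure_of G \<subseteq> (\<Union>i. W i)}"
  then have G: "openin Y G" "Y closure_of G \<subseteq> (\<Union>i. W i)" by auto
  have "compactin Y (Y closure_of G)"
    by (simp add: closedin_compact_space[OF Y(2)])
  then obtain \<F> where \<F>: "finite \<F>" "\<F> \<subseteq> range W" "Y closure_of G \<subseteq> \<Union>\<F>"
    using G W unfolding compactin_def by (metis (no_types, lifting) image_iff)
  obtain I where I: "finite I" "\<F> = W ` I"
    using \<F> finite_subset_image by (metis)
  obtain n where "I \<subseteq> {..<n}"
    using I(1) finite_nat_iff_bounded by blast
  then have "Y closure_of G \<subseteq> (\<Union>i<n. W i)"
    using \<F> I by blast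
  then have "ennreal (m G) \<le> inner_content Y m (\<Union>i<n. W i)"
    by (intro inner_content_upper G)
  also have "\<dots> \<le> (\<Sum>i<n. inner_content Y m (W i))"
    by (rule inner_content_finite_UN_le[OF m Y(1) W])
  also have "\<dots> \<le> (\<Sum>i. inner_content Y m (W i))"
    by (rule sum_le_suminf) auto
  finally show "ennreal (m G) \<le> (\<Sum>i. inner_content Y m (W i))" .
qed

lemma outer_content_le: "openin Y W \<Longrightarrow> A \<subseteq> W \<Longrightarrow> outer_content Y m A \<le> inner_content Y m W"
  unfolding outer_content_def by (rule INF_lower) auto

lemma outer_content_open:
  assumes "openin Y W" shows "outer_content Y m W = inner_content Y m W"
proof (rule antisym)
  show "outer_content Y m W \<le> inner_content Y m W"
    using assms by (intro outer_content_le) auto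
  show "inner_content Y m W \<le> outer_content Y m W"
    unfolding outer_content_def by (rule INF_greatest) (auto intro: inner_content_mono)
qed

lemma outer_measure_space_outer_content:
  assumes m: "m \<in> prob_charges K" and Y: "normal_space Y" "compact_space Y"
  shows "outer_measure_space (Pow (topspace Y)) (outer_content Y m)"
  unfolding outer_measure_space_def
proof (intro conjI)
  show "positive (Pow (topspace Y)) (outer_content Y m)"
    using outer_content_open[of Y "{}" m] by (simp add: positive_def inner_content_empty[OF m])
  show "increasing (Pow (topspace Y)) (outer_content Y m)"
    unfolding increasing_def outer_content_def by (auto intro!: INF_superset_mono)
  show "countably_subadditive (Pow (topspace Y)) (outer_content Y m)"
    unfolding countably_subadditive_def
  proof (intro allI impI)
    fix A :: "nat \<Rightarrow> 'a set" assume A: "range A \<subseteq> Pow (topspace Y)"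
    let ?O = "outer_content Y m"
    show "?O (\<Union>i. A i) \<le> (\<Sum>i. ?O (A i))"
    proof (rule ennreal_le_epsilon)
      fix b and e :: real assume "0 < e" "(\<Sum>i. ?O (A i)) < top"
      \<comment> \<open>A finite series has finite terms, so adding a positive share of
        \<open>e\<close> is a strict increase; the shares add up to \<open>e\<close>.\<close>
      then have *: "\<And>n. ?O (A n) < ?O (A n) + e * (1/2)^Suc n"
        by (auto simp add: less_top dest!: ennreal_suminf_lessD)
      have "\<exists>W. openin Y W \<and> A n \<subseteq> W \<and> inner_content Y m W \<le> ?O (A n) + e * (1/2)^Suc n" for n
        using *[of n] unfolding outer_content_def INF_less_iff by (auto intro: less_imp_le)
      then obtain W where W: "\<And>n. openin Y (W n)" "\<And>n. A n \<subseteq> W n"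
        and le: "\<And>n. inner_content Y m (W n) \<le> ?O (A n) + e * (1/2)^Suc n"
        by metis
      have "?O (\<Union>i. A i) \<le> inner_content Y m (\<Union>i. W i)"
        using W by (intro outer_content_le) auto
      also have "\<dots> \<le> (\<Sum>i. inner_content Y m (W i))"
        by (rule inner_content_UN_le[OF m Y W(1)])
      also have "\<dots> \<le> (\<Sum>n. ?O (A n) + e * (1/2) ^ Suc n)"
        by (intro suminf_le le) auto
      also have "\<dots> = (\<Sum>n. ?O (A n)) + (\<Sum>n. ennreal e * ennreal ((1/2) ^ Suc n))"
        using \<open>0 < e\<close> by (subst suminf_add[symmetric])
          (auto simp del: ennreal_suminf_cmult simp add: ennreal_mult[symmetric])
      also have "\<dots> = (\<Sum>n. ?O (A n)) + e"
        unfolding ennreal_suminf_cmult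
        by (subst suminf_ennreal_eq[OF zero_le_power power_half_series]) auto
      finally show "?O (\<Union>i. A i) \<le> (\<Sum>n. ?O (A n)) + e" .
    qed
  qed
qed

text \<open>Let \<open>V\<close> be an open set containing the test set and \<open>G\<close>
  admissible for the part of \<open>V\<close> in \<open>U\<close>. Removing the closure of
  \<open>G\<close> from \<open>V\<close> leaves an open set that misses \<open>G\<close> and still
  contains the part of the test set outside \<open>U\<close>, so superadditivity applies; then vary
  \<open>G\<close> and \<open>V\<close>. The reverse inequality is subadditivity.\<close>

lemma open_in_lambda_system_outer_content:
  assumes m: "m \<in> prob_charges K" and Y: "normal_space Y" "compact_space Y" and U: "openin Y U"
  shows "U \<in> lambda_system (topspace Y) (Pow (topspace Y)) (outer_content Y m)"
proof -
  interpret sigma_algebra "topspace Y" "Pow (topspace Y)" by (rule sigma_algebra_Pow)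
  let ?O = "outer_content Y m"
  have "?O (A \<inter> U) + ?O (A - U) = ?O A" if A: "A \<subseteq> topspace Y" for A
  proof (rule antisym)
    show "?O (A \<inter> U) + ?O (A - U) \<le> ?O A"
      unfolding outer_content_def[of Y m A]
    proof (rule INF_greatest)
      fix V assume "V \<in> {V. openin Y V \<and> A \<subseteq> V}"
      then have V: "openin Y V" "A \<subseteq> V" by auto
      have ne: "{G. openin Y G \<and> Y closure_of G \<subseteq> V \<inter> U} \<noteq> {}"
        by (auto intro!: exI[of _ "{}"])
      have "?O (A \<inter> U) + ?O (A - U) \<le> inner_content Y m (V \<inter> U) + ?O (A - U)"
        using V U by (intro add_right_mono outer_content_le) auto
      also have "\<dots> = (SUP G\<in>{G. openin Y G \<and> Y closure_of G \<subseteq> V \<inter> U}. ennreal (m G) + ?O (A - U))"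
        unfolding inner_content_def by (rule ennreal_SUP_add_left[OF ne, symmetric])
      also have "\<dots> \<le> inner_content Y m V"
      proof (rule SUP_least)
        fix G assume "G \<in> {G. openin Y G \<and> Y closure_of G \<subseteq> V \<inter> U}"
        then have G: "openin Y G" "Y closure_of G \<subseteq> V \<inter> U" by auto
        have "G \<subseteq> Y closure_of G"
          using G by (simp add: closure_of_subset openin_subset)
        have "ennreal (m G) + ?O (A - U) \<le> ennreal (m G) + inner_content Y m (V - Y closure_of G)"
          using V G by (intro add_left_mono outer_content_le) (auto intro: openin_diff)
        also have "\<dots> \<le> inner_content Y m V"
          using G \<open>G \<subseteq> Y closure_of G\<close> by (intro inner_content_disjoint_le[OF m]) auto
        finally show "ennreal (m G) + ?O (A - U) \<le> inner_content Y m V" .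
      qed
      finally show "?O (A \<inter> U) + ?O (A - U) \<le> inner_content Y m V" .
    qed
    have "outer_measure_space (Pow (topspace Y)) ?O"
      by (rule outer_measure_space_outer_content[OF m Y])
    then have "subadditive (Pow (topspace Y)) ?O"
      by (auto simp: outer_measure_space_def intro: countably_subadditive_subadditive)
    then show "?O A \<le> ?O (A \<inter> U) + ?O (A - U)"
      using subadditiveD[of "Pow (topspace Y)" ?O "A \<inter> U" "A - U"] A
      by (auto simp: Int_Diff_Un)
  qed
  then show ?thesis
    using openin_subset[OF U] unfolding lambda_system_eq by auto
qed

text \<open>Caratheodory's theorem applied to the regularisation of a finitely additive measure, which
  can only decrease the measure of open sets.\<close>

lemma prob_charge_regularisation:
  assumes m: "m \<in> prob_charges K" and K: "K \<subseteq> topspace Y"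
    and Y: "compact_space Y" "Hausdorff_space Y"
  obtains \<mu> where "prob_space \<mu>" "space \<mu> = topspace Y"
    "sets \<mu> = sigma_sets (topspace Y) {U. openin Y U}"
    "\<And>U. openin Y U \<Longrightarrow> measure \<mu> U \<le> m U"
proof -
  have normal: "normal_space Y"
    using Y by (intro compact_Hausdorff_or_regular_imp_normal_space) auto
  interpret sigma_algebra "topspace Y" "Pow (topspace Y)" by (rule sigma_algebra_Pow)
  let ?O = "outer_content Y m" and ?S = "sigma_sets (topspace Y) {U. openin Y U}"
  define L where "L = lambda_system (topspace Y) (Pow (topspace Y)) ?O"
  have L: "measure_space (topspace Y) L ?O"
    unfolding L_def by (rule caratheodory_lemma[OF outer_measure_space_outer_content[OF m normal Y(1)]])
  then interpret L: sigma_algebra "topspace Y" L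
    by (simp add: measure_space_def)
  have sub: "?S \<subseteq> L"
    using open_in_lambda_system_outer_content[OF m normal Y(1)]
    by (intro L.sigma_sets_subset) (auto simp: L_def)
  have sig: "sigma_algebra (topspace Y) ?S"
    by (intro sigma_algebra_sigma_sets) (auto dest: openin_subset)
  have ms: "measure_space (topspace Y) ?S ?O"
    using L sub sig unfolding measure_space_def positive_def countably_additive_def by blast
  define \<mu> where "\<mu> = measure_of (topspace Y) ?S ?O"
  have sp: "space \<mu> = topspace Y" and se: "sets \<mu> = ?S"
    using sig unfolding \<mu>_def
    by (auto simp: sigma_algebra.sets_measure_of_eq sigma_algebra.space_measure_of_eq)
  have em: "emeasure \<mu> A = ?O A" if "A \<in> ?S" for A
    unfolding \<mu>_def using ms that sig
    by (intro emeasure_measure_of_sigma) (auto simp: measure_space_def)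
  have emo: "emeasure \<mu> U = inner_content Y m U" if "openin Y U" for U
    using that em[of U] by (auto simp: outer_content_open)
  \<comment> \<open>The whole space is open and its own closure, so it is admissible for itself and
    regularisation loses no total mass.\<close>
  have one: "emeasure \<mu> (space \<mu>) = 1"
  proof (rule antisym)
    have 1: "m (topspace Y) = 1" by (rule prob_charges_superset[OF m K])
    show "emeasure \<mu> (space \<mu>) \<le> 1"
      using inner_content_le[OF m, of Y "topspace Y"] 1 by (simp add: sp emo)
    show "1 \<le> emeasure \<mu> (space \<mu>)"
      using inner_content_upper[of Y "topspace Y" "topspace Y" m] 1 by (simp add: sp emo)
  qed
  then interpret prob_space \<mu> by (rule prob_spaceI)
  have "measure \<mu> U \<le> m U" if "openin Y U" for U
    using inner_content_le[OF m, of Y U] emo[OF that] prob_charges_nonneg[OF m, of U]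
    by (metis emeasure_eq_measure ennreal_le_iff)
  then show thesis
    using that[of \<mu>] sp se prob_space_axioms by blast
qed

section \<open>Minimax duality\<close>

text \<open>By Tychonoff's theorem the cube of all functions from sets to the unit interval is
  compact, and the charges form a closed subset of it.\<close>

lemma compact_prob_charges: "compact (prob_charges K)"
proof -
  let ?C = "PiE UNIV (\<lambda>_::'a set. {0..1::real})"
  have "compactin (product_topology (\<lambda>_. euclidean) UNIV) ?C"
    by (auto simp: compactin_PiE)
  then have C: "compact ?C"
    by (simp add: euclidean_product_topology)
  have "closed {m :: 'a set \<Rightarrow> real. m A = x}" for A x
    by (intro closed_Collect_eq continuous_on_product_coordinates continuous_on_const)
  moreover have "closed {m :: 'a set \<Rightarrow> real. 0 \<le> m A}" for A
    by (intro closed_Collect_le continuous_on_product_coordinates continuous_on_const)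
  moreover have "closed {m :: 'a set \<Rightarrow> real. A \<inter> B = {} \<longrightarrow> m (A \<union> B) = m A + m B}" for A B
    by (cases "A \<inter> B = {}")
      (auto intro!: closed_Collect_eq continuous_on_product_coordinates continuous_on_add)
  ultimately have "closed (prob_charges K)"
    unfolding prob_charges_def by (intro closed_Collect_conj closed_Collect_all) auto
  then have "compact (?C \<inter> prob_charges K)"
    by (rule compact_Int_closed[OF C])
  moreover have "prob_charges K \<subseteq> ?C"
  proof
    fix m assume m: "m \<in> prob_charges K"
    have "m A \<le> 1" for A
      using prob_charges_mono[OF m, of A "UNIV"] prob_charges_superset[OF m, of UNIV] by simp
    then show "m \<in> ?C"
      using prob_charges_nonneg[OF m] by auto
  qed
  ultimately show ?thesis by (simp add: Int_absorb1)
qed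

lemma dirac_in_prob_charges: "x \<in> K \<Longrightarrow> (\<lambda>A. indicator A x) \<in> prob_charges K"
  by (auto simp: prob_charges_def indicator_def)

lemma convex_comb_in_prob_charges:
  assumes "m \<in> prob_charges K" "m' \<in> prob_charges K" "0 \<le> t" "t \<le> (1::real)"
  shows "(\<lambda>A. (1 - t) * m A + t * m' A) \<in> prob_charges K"
proof -
  have "0 \<le> (1 - t) * m A + t * m' A" for A
    using assms by (simp add: prob_charges_nonneg)
  moreover have "(1 - t) * m (A \<union> B) + t * m' (A \<union> B)
      = (1 - t) * m A + t * m' A + ((1 - t) * m B + t * m' B)" if "A \<inter> B = {}" for A B
    using prob_charges_Un[OF assms(1) that] prob_charges_Un[OF assms(2) that]
    by (simp add: algebra_simps)
  moreover have "m K = 1" "m' K = 1" "m (- K) = 0" "m' (- K) = 0"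
    using assms(1,2) by (auto simp: prob_charges_def)
  ultimately show ?thesis
    by (simp add: prob_charges_def)
qed

text \<open>Bounds a squared excess after a perturbation by a polynomial in the perturbation, which
  replaces differentiating the positive part.\<close>

lemma max_0_add_square_le:
  fixes u v :: real
  shows "(max 0 (u + v))\<^sup>2 \<le> (max 0 u + v)\<^sup>2"
proof (rule abs_le_square_iff[THEN iffD1])
  show "\<bar>max 0 (u + v)\<bar> \<le> \<bar>max 0 u + v\<bar>" by linarith
qed

text \<open>The derivative test at the end point of a segment. If \<open>p\<close> were negative,
  the chosen \<open>t\<close> would be so small that the quadratic term could cancel at most half of
  the linear one.\<close>

lemma nonneg_if_linear_plus_quadratic_nonneg:
  fixes p q :: real
  assumes "\<And>t. 0 < t \<Longrightarrow> t \<le> 1 \<Longrightarrow> 0 \<le> t * p + t\<^sup>2 * q"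
  shows "0 \<le> p"
proof (rule ccontr)
  assume "\<not> 0 \<le> p"
  define t where "t = min 1 (- p / (2 * (\<bar>q\<bar> + 1)))"
  have t: "0 < t" "t \<le> 1" using \<open>\<not> 0 \<le> p\<close> by (auto simp: t_def field_simps)
  have "t \<le> - p / (2 * (\<bar>q\<bar> + 1))" by (simp add: t_def)
  then have "t * (\<bar>q\<bar> + 1) \<le> - p / 2"
    by (subst (asm) pos_le_divide_eq) (auto simp: algebra_simps)
  moreover have "t * q \<le> t * (\<bar>q\<bar> + 1)" using t by (intro mult_left_mono) auto
  ultimately have "p + t * q < 0" using \<open>\<not> 0 \<le> p\<close> by linarith
  moreover have "0 \<le> t * (p + t * q)"
    using assms[OF t] by (simp add: power2_eq_square algebra_simps)
  ultimately show False using t by (simp add: zero_le_mult_iff)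
qed

text \<open>The alternative is the optimality condition at a minimiser of the sum of the squared
  excesses, tested against Dirac masses.\<close>

lemma prob_charge_minimax_finite:
  fixes r :: "'j \<Rightarrow> real"
  assumes J: "finite J" and r: "\<And>j. j \<in> J \<Longrightarrow> 0 \<le> r j" and K: "K \<noteq> {}"
    and weights: "\<And>c. (\<And>j. j \<in> J \<Longrightarrow> 0 \<le> c j) \<Longrightarrow>
      (\<And>x. x \<in> K \<Longrightarrow> 1 \<le> (\<Sum>j\<in>J. c j * indicator (B j) x)) \<Longrightarrow> 1 \<le> (\<Sum>j\<in>J. c j * r j)"
  shows "\<exists>m\<in>prob_charges K. \<forall>j\<in>J. m (B j) \<le> r j"
proof -
  define \<Phi> where "\<Phi> m = (\<Sum>j\<in>J. (max 0 (m (B j) - r j))\<^sup>2)" for m :: "'a set \<Rightarrow> real"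
  have "continuous_on (prob_charges K) \<Phi>"
    unfolding \<Phi>_def
    by (intro continuous_on_sum continuous_on_power continuous_on_max continuous_on_diff continuous_on_const
        continuous_on_subset[OF continuous_on_product_coordinates subset_UNIV])
  moreover have "prob_charges K \<noteq> {}"
  proof -
    obtain x where "x \<in> K" using K by blast
    from dirac_in_prob_charges[OF this] show ?thesis by (metis empty_iff)
  qed
  ultimately obtain m where m: "m \<in> prob_charges K" and min: "\<And>m'. m' \<in> prob_charges K \<Longrightarrow> \<Phi> m \<le> \<Phi> m'"
    using continuous_attains_inf[OF compact_prob_charges, of K \<Phi>] by blast
  \<comment> \<open>Up to a factor 2, \<open>w\<close> is the gradient of \<open>\<Phi>\<close> at
    the minimiser, and \<open>b\<close> is its pairing with \<open>m\<close>.\<close>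
  define w where "w j = max 0 (m (B j) - r j)" for j
  define b where "b = (\<Sum>j\<in>J. w j * m (B j))"
  \<comment> \<open>Moving from \<open>m\<close> towards the Dirac mass at \<open>x\<close> cannot
    lower \<open>\<Phi>\<close>. The derivative in that direction is twice the sum of
    \<open>w j * v j\<close>, and its nonnegativity is the claim.\<close>
  have key: "b \<le> (\<Sum>j\<in>J. w j * indicator (B j) x)" if x: "x \<in> K" for x
  proof -
    define v where "v j = indicator (B j) x - m (B j)" for j
    have "0 \<le> t * (\<Sum>j\<in>J. 2 * w j * v j) + t\<^sup>2 * (\<Sum>j\<in>J. (v j)\<^sup>2)" if t: "0 < t" "t \<le> 1" for t :: real
    proof -
      let ?m = "\<lambda>A. (1 - t) * m A + t * indicator A x"
      have "\<Phi> m \<le> \<Phi> ?m"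
        using t by (intro min convex_comb_in_prob_charges m dirac_in_prob_charges x) auto
      also have "\<dots> \<le> (\<Sum>j\<in>J. (w j + t * v j)\<^sup>2)"
        unfolding \<Phi>_def w_def
      proof (rule sum_mono)
        fix j
        show "(max 0 ((1 - t) * m (B j) + t * indicator (B j) x - r j))\<^sup>2
            \<le> (max 0 (m (B j) - r j) + t * v j)\<^sup>2"
          using max_0_add_square_le[of "m (B j) - r j" "t * v j"] by (simp add: v_def algebra_simps)
      qed
      also have "\<dots> = \<Phi> m + (t * (\<Sum>j\<in>J. 2 * w j * v j) + t\<^sup>2 * (\<Sum>j\<in>J. (v j)\<^sup>2))"
        unfolding \<Phi>_def w_def[symmetric] sum_distrib_left sum.distrib[symmetric]
        by (intro sum.cong refl) (simp add: power2_eq_square algebra_simps)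
      finally show ?thesis by simp
    qed
    then have "0 \<le> (\<Sum>j\<in>J. 2 * w j * v j)"
      by (rule nonneg_if_linear_plus_quadratic_nonneg)
    then have "0 \<le> (\<Sum>j\<in>J. w j * v j)"
      by (simp add: mult.assoc flip: sum_distrib_left)
    then show ?thesis
      by (simp add: v_def b_def algebra_simps sum_subtractf)
  qed
  \<comment> \<open>Where \<open>w j\<close> does not vanish, \<open>m (B j)\<close> equals
    \<open>w j + r j\<close>.\<close>
  have b: "b = \<Phi> m + (\<Sum>j\<in>J. w j * r j)"
    unfolding b_def \<Phi>_def w_def[symmetric] sum.distrib[symmetric]
  proof (rule sum.cong)
    fix j
    show "w j * m (B j) = (w j)\<^sup>2 + w j * r j"
      by (auto simp: w_def max_def power2_eq_square algebra_simps)
  qed simp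
  have "\<Phi> m = 0"
  proof (rule ccontr)
    assume "\<Phi> m \<noteq> 0"
    moreover have "0 \<le> \<Phi> m" unfolding \<Phi>_def by (intro sum_nonneg) auto
    ultimately have pos: "0 < \<Phi> m" by simp
    have "0 \<le> (\<Sum>j\<in>J. w j * r j)" using r by (intro sum_nonneg mult_nonneg_nonneg) (auto simp: w_def)
    then have "0 < b" using pos b by simp
    \<comment> \<open>By \<open>key\<close> the weights \<open>w j / b\<close> cover
      \<open>K\<close>, so they must cost at least 1; but their cost is
      \<open>(b - \<Phi> m) / b\<close>, which is smaller than 1.\<close>
    have "1 \<le> (\<Sum>j\<in>J. w j / b * r j)"
    proof (rule weights)
      show "0 \<le> w j / b" for j using \<open>0 < b\<close> by (simp add: w_def)
      show "1 \<le> (\<Sum>j\<in>J. w j / b * indicator (B j) x)" if "x \<in> K" for x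
        using key[OF that] \<open>0 < b\<close> by (simp add: sum_divide_distrib[symmetric])
    qed
    then show False
      using \<open>0 < b\<close> b pos by (simp add: sum_divide_distrib[symmetric])
  qed
  then have "w j = 0" if "j \<in> J" for j
    using that J by (simp add: \<Phi>_def sum_nonneg_eq_0_iff w_def)
  then have "m (B j) \<le> r j" if "j \<in> J" for j
    using that max.cobounded2[of "m (B j) - r j" 0] by (fastforce simp: w_def)
  then show ?thesis
    using m by blast
qed

text \<open>Each bound cuts out a closed set of charges, so by compactness it suffices to satisfy
  finitely many bounds at a time.\<close>

lemma prob_charge_minimax:
  fixes r :: "'j \<Rightarrow> real"
  assumes r: "\<And>j. j \<in> J \<Longrightarrow> 0 \<le> r j" and K: "K \<noteq> {}"
    and weights: "\<And>I c. finite I \<Longrightarrow> I \<subseteq> J \<Longrightarrow> (\<And>j. j \<in> I \<Longrightarrow> 0 \<le> c j) \<Longrightarrow>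
      (\<And>x. x \<in> K \<Longrightarrow> 1 \<le> (\<Sum>j\<in>I. c j * indicator (B j) x)) \<Longrightarrow> 1 \<le> (\<Sum>j\<in>I. c j * r j)"
  shows "\<exists>m\<in>prob_charges K. \<forall>j\<in>J. m (B j) \<le> r j"
proof -
  have "prob_charges K \<inter> (\<Inter>j\<in>J. {m. m (B j) \<le> r j}) \<noteq> {}"
  proof (rule compact_imp_fip_image[OF compact_prob_charges])
    show "closed {m. m (B j) \<le> r j}" for j
      by (intro closed_Collect_le continuous_on_product_coordinates continuous_on_const)
    fix I assume I: "finite I" "I \<subseteq> J"
    then have "\<exists>m\<in>prob_charges K. \<forall>j\<in>I. m (B j) \<le> r j"
      by (intro prob_charge_minimax_finite weights K r) auto
    then show "prob_charges K \<inter> (\<Inter>j\<in>I. {m. m (B j) \<le> r j}) \<noteq> {}" by blast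
  qed
  then show ?thesis by blast
qed

section \<open>Integrals and measures\<close>

lemma enn2ereal_ennreal_diff: "enn2ereal (ennreal s) - enn2ereal (ennreal (- s)) = ereal s"
  by (cases "0 \<le> s") (auto simp: enn2ereal_ennreal ennreal_neg zero_ennreal.rep_eq)

text \<open>\<open>nn_integral\<close> is monotone under almost everywhere inequalities between
  arbitrary functions, so the bound applies to a local pressure of unknown measurability. The
  default value of an undefined integral, minus infinity, respects an upper bound.\<close>

lemma ereal_integral_le:
  assumes "prob_space \<mu>" and le: "AE x in \<mu>. g x \<le> ereal s"
  shows "ereal_integral \<mu> g \<le> ereal s"
proof -
  interpret prob_space \<mu> by fact
  let ?p = "\<integral>\<^sup>+ x. e2ennreal (g x) \<partial>\<mu>" and ?q = "\<integral>\<^sup>+ x. e2ennreal (- g x) \<partial>\<mu>"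
  have "?p \<le> (\<integral>\<^sup>+ x. e2ennreal (ereal s) \<partial>\<mu>)"
    by (intro nn_integral_mono_AE eventually_mono[OF le] e2ennreal_mono)
  then have p: "?p \<le> ennreal s"
    by (simp add: emeasure_space_1 ennreal.abs_eq)
  have "(\<integral>\<^sup>+ x. e2ennreal (- ereal s) \<partial>\<mu>) \<le> ?q"
    by (intro nn_integral_mono_AE eventually_mono[OF le] e2ennreal_mono ereal_minus_le_minus[THEN iffD2])
  then have q: "ennreal (- s) \<le> ?q"
    by (simp add: emeasure_space_1 ennreal.abs_eq)
  have "enn2ereal ?p \<le> enn2ereal (ennreal s)" "enn2ereal (ennreal (- s)) \<le> enn2ereal ?q"
    using p q by (simp_all add: less_eq_ennreal.rep_eq)
  then have "enn2ereal ?p - enn2ereal ?q \<le> enn2ereal (ennreal s) - enn2ereal (ennreal (- s))"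
    by (rule ereal_minus_mono)
  also have "\<dots> = ereal s"
    by (rule enn2ereal_ennreal_diff)
  finally show ?thesis
    unfolding ereal_integral_def Let_def by simp
qed

lemma ereal_integral_ge:
  assumes "prob_space \<mu>" and le: "AE x in \<mu>. ereal s \<le> g x"
  shows "ereal s \<le> ereal_integral \<mu> g"
proof -
  interpret prob_space \<mu> by fact
  let ?p = "\<integral>\<^sup>+ x. e2ennreal (g x) \<partial>\<mu>" and ?q = "\<integral>\<^sup>+ x. e2ennreal (- g x) \<partial>\<mu>"
  have "(\<integral>\<^sup>+ x. e2ennreal (ereal s) \<partial>\<mu>) \<le> ?p"
    by (intro nn_integral_mono_AE eventually_mono[OF le] e2ennreal_mono)
  then have p: "ennreal s \<le> ?p"
    by (simp add: emeasure_space_1 ennreal.abs_eq)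
  have "?q \<le> (\<integral>\<^sup>+ x. e2ennreal (- ereal s) \<partial>\<mu>)"
    by (intro nn_integral_mono_AE eventually_mono[OF le] e2ennreal_mono ereal_minus_le_minus[THEN iffD2])
  then have q: "?q \<le> ennreal (- s)"
    by (simp add: emeasure_space_1 ennreal.abs_eq)
  \<comment> \<open>A lower bound must exclude the default value minus infinity, which finiteness of
    the negative part does.\<close>
  then have "?q \<noteq> \<infinity>"
    by (auto simp: top_unique)
  have "enn2ereal (ennreal s) \<le> enn2ereal ?p" "enn2ereal ?q \<le> enn2ereal (ennreal (- s))"
    using p q by (simp_all add: less_eq_ennreal.rep_eq)
  then have "enn2ereal (ennreal s) - enn2ereal (ennreal (- s)) \<le> enn2ereal ?p - enn2ereal ?q"
    by (rule ereal_minus_mono)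
  moreover have "enn2ereal (ennreal s) - enn2ereal (ennreal (- s)) = ereal s"
    by (rule enn2ereal_ennreal_diff)
  ultimately show ?thesis
    using \<open>?q \<noteq> \<infinity>\<close> unfolding ereal_integral_def Let_def by simp
qed

lemma emeasure_UN_le_infsum:
  fixes I :: "nat set"
  assumes I: "\<And>i. i \<in> I \<Longrightarrow> B i \<in> sets M" and le: "\<And>i. i \<in> I \<Longrightarrow> emeasure M (B i) \<le> g i"
  shows "emeasure M (\<Union>i\<in>I. B i) \<le> (\<Sum>\<^sub>\<infinity>i\<in>I. g i)"
proof -
  let ?F = "\<lambda>i. if i \<in> I then B i else {}"
  have "(\<Union>i\<in>I. B i) = (\<Union>i. ?F i)" by auto
  also have "emeasure M \<dots> \<le> (\<Sum>i. emeasure M (?F i))"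
    using I by (intro emeasure_subadditive_countably) auto
  also have "\<dots> = (SUP n. \<Sum>i<n. emeasure M (?F i))"
    by (rule suminf_eq_SUP)
  also have "\<dots> \<le> (\<Sum>\<^sub>\<infinity>i\<in>I. g i)"
  proof (rule SUP_least)
    fix n
    have "(\<Sum>i<n. emeasure M (?F i)) = (\<Sum>i\<in>{..<n} \<inter> I. emeasure M (?F i))"
      by (rule sum.mono_neutral_right) auto
    also have "\<dots> \<le> (\<Sum>i\<in>{..<n} \<inter> I. g i)"
      by (intro sum_mono) (auto intro: le)
    also have "\<dots> = (\<Sum>\<^sub>\<infinity>i\<in>{..<n} \<inter> I. g i)"
      by simp
    also have "\<dots> \<le> (\<Sum>\<^sub>\<infinity>i\<in>I. g i)"
      by (intro infsum_mono_neutral nonneg_summable_on_complete) auto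
    finally show "(\<Sum>i<n. emeasure M (?F i)) \<le> (\<Sum>\<^sub>\<infinity>i\<in>I. g i)" .
  qed
  finally show ?thesis .
qed

section \<open>Ball measures on the exponential scale, Borel sets, and monotone limits\<close>

lemma measure_le_exp_if_neg_log_measure_greater:
  assumes "0 < n" and gt: "ereal s < (neg_log_measure \<mu> A + ereal b) / ereal (real n)"
  shows "measure \<mu> A \<le> exp (- real n * s + b)"
proof (cases "measure \<mu> A = 0")
  case False
  then have pos: "0 < measure \<mu> A" by (simp add: zero_less_measure_iff)
  have "s < (- ln (measure \<mu> A) + b) / real n"
    using gt False \<open>0 < n\<close> by (simp add: neg_log_measure_def)
  then have "ln (measure \<mu> A) \<le> - real n * s + b"
    using \<open>0 < n\<close> by (simp add: field_simps)
  then show ?thesis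
    using pos by (metis exp_le_cancel_iff exp_ln)
qed simp

lemma neg_log_measure_antimono:
  assumes "finite_measure \<mu>" "A \<subseteq> B" "B \<in> sets \<mu>"
  shows "neg_log_measure \<mu> B \<le> neg_log_measure \<mu> A"
proof (cases "measure \<mu> A = 0")
  case False
  have "measure \<mu> A \<le> measure \<mu> B"
    by (rule finite_measure.finite_measure_mono[OF assms])
  moreover have "0 < measure \<mu> A"
    using False by (simp add: zero_less_measure_iff)
  ultimately show ?thesis
    by (simp add: neg_log_measure_def)
qed (simp add: neg_log_measure_def)

lemma open_in_borel_prob_measures:
  "\<mu> \<in> borel_prob_measures m \<Longrightarrow> openin (mtopology_of m) U \<Longrightarrow> U \<in> sets \<mu>"
  by (auto simp: borel_prob_measures_def)

lemma closed_in_borel_prob_measures: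
  assumes "\<mu> \<in> borel_prob_measures m" "closedin (mtopology_of m) C"
  shows "C \<in> sets \<mu>"
proof -
  have "space \<mu> - (mspace m - C) \<in> sets \<mu>"
    using assms open_in_borel_prob_measures[OF assms(1), of "mspace m - C"]
    by (intro sets.compl_sets) (auto simp: closedin_def)
  moreover have "space \<mu> - (mspace m - C) = C"
    using assms closedin_subset[OF assms(2)] by (auto simp: borel_prob_measures_def)
  ultimately show ?thesis by simp
qed

text \<open>The numbers \<open>exp (- real n * \<delta>)\<close> later serve as weight thresholds
  for the orders \<open>n\<close>. Beyond \<open>M\<close> they add up to at most 1, so a total
  weight of 1 forces some order to reach its threshold.\<close>

lemma exp_sum_tail_le_1:
  assumes "0 < \<delta>"
  obtains M where "\<And>F. finite F \<Longrightarrow> F \<subseteq> {M..} \<Longrightarrow> (\<Sum>n\<in>F. exp (- real n * \<delta>)) \<le> 1"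
proof -
  let ?g = "\<lambda>n. exp (- real n * \<delta>)"
  have "?g = (\<lambda>n. exp (- \<delta>) ^ n)"
    by (auto simp: exp_of_nat_mult[symmetric])
  moreover have "summable (\<lambda>n. exp (- \<delta>) ^ n)"
    using assms by (intro summable_geometric) auto
  ultimately have "summable ?g" by simp
  then obtain M where M: "\<And>m n. M \<le> m \<Longrightarrow> norm (sum ?g {m..<n}) < 1"
    unfolding summable_Cauchy by (meson zero_less_one)
  have "(\<Sum>n\<in>F. ?g n) \<le> 1" if F: "finite F" "F \<subseteq> {M..}" for F
  proof -
    obtain k where "F \<subseteq> {..<k}" using F(1) finite_nat_iff_bounded by blast
    then have "F \<subseteq> {M..<k}" using F(2) by auto
    then have "sum ?g F \<le> sum ?g {M..<k}" by (intro sum_mono2) auto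
    then show ?thesis using M[of M k] by simp
  qed
  then show thesis by (rule that)
qed

text \<open>Turns the limits in the definitions of the pressures into suprema, from which single
  radii can be extracted.\<close>

lemma Lim_at_right_antimono:
  fixes g :: "real \<Rightarrow> ereal"
  assumes "\<And>\<epsilon> \<epsilon>'. 0 < \<epsilon> \<Longrightarrow> \<epsilon> \<le> \<epsilon>' \<Longrightarrow> g \<epsilon>' \<le> g \<epsilon>"
  shows "Lim (at_right 0) g = (SUP \<epsilon>\<in>{0<..}. g \<epsilon>)"
proof (rule tendsto_Lim)
  show "(g \<longlongrightarrow> (SUP \<epsilon>\<in>{0<..}. g \<epsilon>)) (at_right 0)"
  proof (rule increasing_tendsto)
    show "\<forall>\<^sub>F \<epsilon> in at_right 0. g \<epsilon> \<le> (SUP \<epsilon>\<in>{0<..}. g \<epsilon>)"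
      by (auto simp: eventually_at_right_field intro!: exI[of _ 1] SUP_upper)
    fix y assume "y < (SUP \<epsilon>\<in>{0<..}. g \<epsilon>)"
    then obtain e where "0 < e" "y < g e" by (auto simp: less_SUP_iff)
    then show "\<forall>\<^sub>F \<epsilon> in at_right 0. y < g \<epsilon>"
      using assms by (force simp: eventually_at_right_field intro!: exI[of _ e] intro: less_le_trans)
  qed
qed simp

section \<open>Bowen balls and pressure\<close>

context nds
begin

lemma iter_continuous: "continuous_map (mtopology_of (X 0)) (mtopology_of (X j)) (iter T j)"
  by (induction j) (auto simp: id_def simp del: o_apply intro: continuous_map_compose continuous_maps)

lemma iter_in_mspace: "x \<in> mspace (X 0) \<Longrightarrow> iter T j x \<in> mspace (X j)"
  using continuous_map_image_subset_topspace[OF iter_continuous[of j]] by auto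

lemma bowen_dist_less_iff:
  "0 < n \<Longrightarrow> bowen_dist X T n x y < e \<longleftrightarrow> (\<forall>j<n. mdist (X j) (iter T j x) (iter T j y) < e)"
  unfolding bowen_dist_def by (subst Max_less_iff) auto

lemma bowen_ball_iff:
  "0 < n \<Longrightarrow> y \<in> bowen_ball X T n x e \<longleftrightarrow>
    y \<in> mspace (X 0) \<and> (\<forall>j<n. mdist (X j) (iter T j x) (iter T j y) < e)"
  by (simp add: bowen_ball_def bowen_dist_less_iff)

lemma bowen_ball_mono: "e \<le> e' \<Longrightarrow> bowen_ball X T n x e \<subseteq> bowen_ball X T n x e'"
  by (auto simp: bowen_ball_def)

lemma bowen_ball_commute:
  "0 < n \<Longrightarrow> x \<in> mspace (X 0) \<Longrightarrow> y \<in> bowen_ball X T n x e \<Longrightarrow> x \<in> bowen_ball X T n y e"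
  by (simp add: bowen_ball_iff mdist_commute)

lemma bowen_ball_trans:
  assumes "0 < n" "x \<in> mspace (X 0)" "y \<in> bowen_ball X T n x e" "z \<in> bowen_ball X T n y e'"
  shows "z \<in> bowen_ball X T n x (e + e')"
  unfolding bowen_ball_iff[OF assms(1)]
proof (intro conjI allI impI)
  have yz: "y \<in> mspace (X 0)" "z \<in> mspace (X 0)"
    using assms by (auto simp: bowen_ball_def)
  then show "z \<in> mspace (X 0)" by simp
  fix j assume "j < n"
  then have "mdist (X j) (iter T j x) (iter T j y) < e" "mdist (X j) (iter T j y) (iter T j z) < e'"
    using assms by (auto simp: bowen_ball_iff)
  moreover have "mdist (X j) (iter T j x) (iter T j z)
      \<le> mdist (X j) (iter T j x) (iter T j y) + mdist (X j) (iter T j y) (iter T j z)"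
    by (intro mdist_triangle iter_in_mspace assms yz)
  ultimately show "mdist (X j) (iter T j x) (iter T j z) < e + e'" by linarith
qed

lemma openin_bowen_ball:
  assumes "0 < n" "x \<in> mspace (X 0)"
  shows "openin (mtopology_of (X 0)) (bowen_ball X T n x e)"
proof -
  have "continuous_map (mtopology_of (X 0)) euclideanreal (\<lambda>y. mdist (X j) (iter T j x) (iter T j y))" for j
    by (intro continuous_map_mdist iter_continuous) (simp add: assms iter_in_mspace)
  then have "openin (mtopology_of (X 0))
      {y \<in> topspace (mtopology_of (X 0)). mdist (X j) (iter T j x) (iter T j y) \<in> {..<e}}" for j
    by (rule openin_continuous_map_preimage) simp
  then have "openin (mtopology_of (X 0))
      (\<Inter>j<n. {y \<in> mspace (X 0). mdist (X j) (iter T j x) (iter T j y) < e})"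
    using assms by (intro openin_INT2) auto
  moreover have "bowen_ball X T n x e
      = (\<Inter>j<n. {y \<in> mspace (X 0). mdist (X j) (iter T j x) (iter T j y) < e})"
    using assms by (auto simp: bowen_ball_iff)
  ultimately show ?thesis by simp
qed

text \<open>Equicontinuity provides one radius valid at all times \<open>j\<close>, so each of the
  \<open>n\<close> terms changes by less than \<open>\<delta>\<close>.\<close>

lemma birkhoff_sum_variation:
  assumes f: "equicontinuous X f" and "0 < \<delta>"
  obtains e where "0 < e"
    "\<And>n x y. 0 < n \<Longrightarrow> x \<in> mspace (X 0) \<Longrightarrow> y \<in> bowen_ball X T n x e \<Longrightarrow>
      \<bar>birkhoff_sum T f n x - birkhoff_sum T f n y\<bar> \<le> real n * \<delta>"
proof -
  obtain e where e: "0 < e" and le: "\<And>k x y. x \<in> mspace (X k) \<Longrightarrow> y \<in> mspace (X k) \<Longrightarrow>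
      mdist (X k) x y < e \<Longrightarrow> \<bar>f k x - f k y\<bar> < \<delta>"
    using assms unfolding equicontinuous_def by metis
  have "\<bar>birkhoff_sum T f n x - birkhoff_sum T f n y\<bar> \<le> real n * \<delta>"
    if "0 < n" "x \<in> mspace (X 0)" "y \<in> bowen_ball X T n x e" for n x y
  proof -
    have "\<bar>birkhoff_sum T f n x - birkhoff_sum T f n y\<bar> \<le> (\<Sum>j<n. \<bar>f j (iter T j x) - f j (iter T j y)\<bar>)"
      unfolding birkhoff_sum_def sum_subtractf[symmetric] by (rule sum_abs)
    also have "\<dots> \<le> (\<Sum>j<n. \<delta>)"
      using that by (intro sum_mono less_imp_le le iter_in_mspace) (auto simp: bowen_ball_iff)
    finally show ?thesis by simp
  qed
  with e show thesis by (rule that)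
qed

section \<open>Monotonicity of local pressures and Bowen sums\<close>

lemma lower_local_pressure_eq_SUP:
  assumes \<mu>: "\<mu> \<in> borel_prob_measures (X 0)" and x: "x \<in> mspace (X 0)"
  shows "lower_local_pressure X T f \<mu> x = (SUP \<epsilon>\<in>{0<..}. liminf (\<lambda>n.
      (neg_log_measure \<mu> (bowen_ball X T n x \<epsilon>) + ereal (birkhoff_sum T f n x)) / ereal (real n)))"
  unfolding lower_local_pressure_def
proof (rule Lim_at_right_antimono)
  fix e e' :: real assume "0 < e" "e \<le> e'"
  have fm: "finite_measure \<mu>"
    using \<mu> by (auto simp: borel_prob_measures_def prob_space_def)
  \<comment> \<open>The ball of order 0 involves an unspecified maximum; the lower limit ignores
    it.\<close>
  have "\<forall>n\<ge>1. neg_log_measure \<mu> (bowen_ball X T n x e') \<le> neg_log_measure \<mu> (bowen_ball X T n x e)"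
    using x \<open>e \<le> e'\<close>
    by (auto intro!: neg_log_measure_antimono fm bowen_ball_mono open_in_borel_prob_measures[OF \<mu>]
        openin_bowen_ball)
  then show "liminf (\<lambda>n. (neg_log_measure \<mu> (bowen_ball X T n x e') + ereal (birkhoff_sum T f n x)) / ereal (real n))
      \<le> liminf (\<lambda>n. (neg_log_measure \<mu> (bowen_ball X T n x e) + ereal (birkhoff_sum T f n x)) / ereal (real n))"
    by (intro Liminf_mono eventually_sequentiallyI[of 1] ereal_divide_right_mono add_right_mono) auto
qed

lemma bowen_sum_inf_mono: "N \<le> N' \<Longrightarrow> bowen_sum_inf X T f s N \<epsilon> Z \<le> bowen_sum_inf X T f s N' \<epsilon> Z"
  unfolding bowen_sum_inf_def by (rule INF_superset_mono) (force simp: bowen_covers_def)+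

lemma bowen_sum_inf_antimono_radius:
  "\<epsilon> \<le> \<epsilon>' \<Longrightarrow> bowen_sum_inf X T f s N \<epsilon>' Z \<le> bowen_sum_inf X T f s N \<epsilon> Z"
  unfolding bowen_sum_inf_def
  by (rule INF_superset_mono) (use bowen_ball_mono in \<open>fastforce simp: bowen_covers_def\<close>)+

lemma bowen_sum_inf_antimono_exponent:
  assumes "s \<le> s'"
  shows "bowen_sum_inf X T f s' N \<epsilon> Z \<le> bowen_sum_inf X T f s N \<epsilon> Z"
  unfolding bowen_sum_inf_def
proof (rule INF_mono)
  fix c assume "c \<in> bowen_covers X T N \<epsilon> Z"
  moreover have "(case c of (I, n, x) \<Rightarrow> \<Sum>\<^sub>\<infinity>i\<in>I. ennreal (exp (- real (n i) * s' + birkhoff_sum T f (n i) (x i))))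
     \<le> (case c of (I, n, x) \<Rightarrow> \<Sum>\<^sub>\<infinity>i\<in>I. ennreal (exp (- real (n i) * s + birkhoff_sum T f (n i) (x i))))"
    using assms by (auto split: prod.splits intro!: infsum_mono nonneg_summable_on_complete ennreal_leI mult_left_mono)
  ultimately show "\<exists>c'\<in>bowen_covers X T N \<epsilon> Z.
     (case c' of (I, n, x) \<Rightarrow> \<Sum>\<^sub>\<infinity>i\<in>I. ennreal (exp (- real (n i) * s' + birkhoff_sum T f (n i) (x i))))
     \<le> (case c of (I, n, x) \<Rightarrow> \<Sum>\<^sub>\<infinity>i\<in>I. ennreal (exp (- real (n i) * s + birkhoff_sum T f (n i) (x i))))"
    by blast
qed

lemma bowen_sum_lim_eq_SUP: "bowen_sum_lim X T f s \<epsilon> Z = (SUP N. bowen_sum_inf X T f s N \<epsilon> Z)"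
  unfolding bowen_sum_lim_def
  by (intro limI LIMSEQ_SUP) (auto simp: incseq_def bowen_sum_inf_mono)

lemma bowen_sum_lim_eq_0_iff: "bowen_sum_lim X T f s \<epsilon> Z = 0 \<longleftrightarrow> (\<forall>N. bowen_sum_inf X T f s N \<epsilon> Z = 0)"
  unfolding bowen_sum_lim_eq_SUP
  by (simp flip: bot_ennreal)

lemma bowen_pressure_eq_SUP: "bowen_pressure X T f Z = (SUP \<epsilon>\<in>{0<..}. bowen_pressure_at X T f Z \<epsilon>)"
  unfolding bowen_pressure_def
proof (rule Lim_at_right_antimono)
  fix e e' :: real assume "e \<le> e'"
  from bowen_sum_inf_antimono_radius[OF this]
  have "bowen_sum_inf X T f s N e' Z = 0" if "bowen_sum_inf X T f s N e Z = 0" for s N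
    using that by (metis le_zero_eq)
  then show "bowen_pressure_at X T f Z e' \<le> bowen_pressure_at X T f Z e"
    unfolding bowen_pressure_at_def bowen_sum_lim_eq_0_iff
    by (intro Inf_superset_mono) blast
qed

text \<open>An exponent \<open>t\<close> entering the infimum makes the sum vanish at every starting
  order, in particular at \<open>N\<close>; were \<open>t\<close> below \<open>s\<close>,
  antimonotonicity in the exponent would make it vanish for \<open>s\<close> as well.\<close>

lemma le_bowen_pressure_atI:
  assumes "bowen_sum_inf X T f s N \<epsilon> Z \<noteq> 0"
  shows "ereal s \<le> bowen_pressure_at X T f Z \<epsilon>"
  unfolding bowen_pressure_at_def
proof (rule Inf_greatest, clarsimp)
  fix t assume "bowen_sum_lim X T f t \<epsilon> Z = 0"
  then have "bowen_sum_inf X T f t N \<epsilon> Z = 0" by (simp add: bowen_sum_lim_eq_0_iff)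
  then show "s \<le> t"
    using bowen_sum_inf_antimono_exponent[of t s f N \<epsilon> Z] assms by (metis le_zero_eq linear)
qed

lemma bowen_sum_inf_le_finite_cover:
  assumes P: "finite P" "P \<subseteq> {N..} \<times> mspace (X 0)"
    and Z: "Z \<subseteq> (\<Union>(n, x)\<in>P. bowen_ball X T n x \<epsilon>)"
  shows "bowen_sum_inf X T f s N \<epsilon> Z \<le> ennreal (\<Sum>(n, x)\<in>P. exp (- real n * s + birkhoff_sum T f n x))"
proof -
  \<comment> \<open>Covers are indexed by sets of natural numbers, so the finite set of pairs is
    enumerated first.\<close>
  obtain h where h: "bij_betw h {0..<card P} P"
    using ex_bij_betw_nat_finite[OF P(1)] by blast
  let ?I = "{0..<card P}"
  have "(?I, fst \<circ> h, snd \<circ> h) \<in> bowen_covers X T N \<epsilon> Z"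
  proof -
    have hI: "h ` ?I = P" using h by (simp add: bij_betw_def)
    have "Z \<subseteq> (\<Union>p\<in>h ` ?I. bowen_ball X T (fst p) (snd p) \<epsilon>)"
      using Z unfolding hI by (simp add: case_prod_unfold)
    then have "Z \<subseteq> (\<Union>i\<in>?I. bowen_ball X T (fst (h i)) (snd (h i)) \<epsilon>)"
      by simp
    moreover have "h i \<in> {N..} \<times> mspace (X 0)" if "i \<in> ?I" for i
      using that hI P(2) by blast
    ultimately show ?thesis by (auto simp: bowen_covers_def mem_Times_iff)
  qed
  then have "bowen_sum_inf X T f s N \<epsilon> Z
      \<le> (\<Sum>\<^sub>\<infinity>i\<in>?I. ennreal (exp (- real (fst (h i)) * s + birkhoff_sum T f (fst (h i)) (snd (h i)))))"
    unfolding bowen_sum_inf_def by (auto intro: INF_lower2)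
  also have "\<dots> = ennreal (\<Sum>i\<in>?I. exp (- real (fst (h i)) * s + birkhoff_sum T f (fst (h i)) (snd (h i))))"
    by (simp add: sum_ennreal)
  also have "(\<Sum>i\<in>?I. exp (- real (fst (h i)) * s + birkhoff_sum T f (fst (h i)) (snd (h i))))
      = (\<Sum>(n, x)\<in>P. exp (- real n * s + birkhoff_sum T f n x))"
    unfolding case_prod_unfold by (rule sum.reindex_bij_betw[OF h])
  finally show ?thesis .
qed

section \<open>Lower bound for the Bowen pressure\<close>

text \<open>The mass distribution principle: the balls of a cheap cover that meet the given set carry
  little measure.\<close>

lemma AE_notin_if_bowen_sum_inf_eq_0:
  assumes \<mu>: "\<mu> \<in> borel_prob_measures (X 0)"
    and A: "A \<subseteq> K" "A \<subseteq> mspace (X 0)" and N: "0 < N"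
    and var: "\<And>n x y. 0 < n \<Longrightarrow> x \<in> mspace (X 0) \<Longrightarrow> y \<in> bowen_ball X T n x \<epsilon> \<Longrightarrow>
      \<bar>birkhoff_sum T f n x - birkhoff_sum T f n y\<bar> \<le> real n * \<delta>"
    and gt: "\<And>x n. x \<in> A \<Longrightarrow> N \<le> n \<Longrightarrow>
      ereal s < (neg_log_measure \<mu> (bowen_ball X T n x (2 * \<epsilon>)) + ereal (birkhoff_sum T f n x)) / ereal (real n)"
    and zero: "bowen_sum_inf X T f (s - \<delta>) N \<epsilon> K = 0"
  shows "AE x in \<mu>. x \<notin> A"
proof -
  interpret prob_space \<mu> using \<mu> by (simp add: borel_prob_measures_def)
  \<comment> \<open>\<open>A\<close> need not be measurable, so it is enclosed in measurable unions
    of balls of arbitrarily small measure, whose intersection over \<open>k\<close> is a null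
    set.\<close>
  have "\<exists>U\<in>sets \<mu>. A \<subseteq> U \<and> emeasure \<mu> U \<le> ennreal (1 / real (Suc k))" for k
  proof -
    have "bowen_sum_inf X T f (s - \<delta>) N \<epsilon> K < ennreal (1 / real (Suc k))"
      unfolding zero by simp
    then obtain I n x where cov: "(I, n, x) \<in> bowen_covers X T N \<epsilon> K"
      and small: "(\<Sum>\<^sub>\<infinity>i\<in>I. ennreal (exp (- real (n i) * (s - \<delta>) + birkhoff_sum T f (n i) (x i))))
        < ennreal (1 / real (Suc k))"
      unfolding bowen_sum_inf_def INF_less_iff by auto
    let ?B = "\<lambda>i. bowen_ball X T (n i) (x i) \<epsilon>"
    let ?J = "{i \<in> I. ?B i \<inter> A \<noteq> {}}"
    have in_I: "x i \<in> mspace (X 0)" "N \<le> n i" "0 < n i" if "i \<in> I" for i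
      using cov that N by (auto simp: bowen_covers_def)
    have sets: "bowen_ball X T n x e \<in> sets \<mu>" if "0 < n" "x \<in> mspace (X 0)" for n x e
      using that by (intro open_in_borel_prob_measures[OF \<mu>] openin_bowen_ball)
    have "emeasure \<mu> (?B i) \<le> ennreal (exp (- real (n i) * (s - \<delta>) + birkhoff_sum T f (n i) (x i)))"
      if i: "i \<in> ?J" for i
    proof -
      obtain y where y: "y \<in> ?B i" "y \<in> A" using i by auto
      have y0: "y \<in> mspace (X 0)" using y A by auto
      have ni: "0 < n i" "N \<le> n i" and xi: "x i \<in> mspace (X 0)" using in_I i by auto
      \<comment> \<open>The hypothesis speaks of balls centred in \<open>A\<close>. Recentring a
        ball of the cover at a point \<open>y\<close> of \<open>A\<close> doubles the radius, and
        replacing the Birkhoff sum at \<open>y\<close> by the one at \<open>x i\<close> costs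
        \<open>\<delta>\<close> in the exponent.\<close>
      have "?B i \<subseteq> bowen_ball X T (n i) y (2 * \<epsilon>)"
        using bowen_ball_trans[OF ni(1) y0 bowen_ball_commute[OF ni(1) xi y(1)], of _ \<epsilon>]
        unfolding mult_2 by blast
      then have "measure \<mu> (?B i) \<le> measure \<mu> (bowen_ball X T (n i) y (2 * \<epsilon>))"
        using sets[OF ni(1) y0] by (intro finite_measure_mono) auto
      also have "\<dots> \<le> exp (- real (n i) * s + birkhoff_sum T f (n i) y)"
        by (rule measure_le_exp_if_neg_log_measure_greater[OF ni(1) gt[OF y(2) ni(2)]])
      also have "\<dots> \<le> exp (- real (n i) * (s - \<delta>) + birkhoff_sum T f (n i) (x i))"
        using var[OF ni(1) xi y(1)] by (simp add: algebra_simps)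
      finally show ?thesis
        by (simp add: emeasure_eq_measure)
    qed
    then have "emeasure \<mu> (\<Union>i\<in>?J. ?B i)
        \<le> (\<Sum>\<^sub>\<infinity>i\<in>?J. ennreal (exp (- real (n i) * (s - \<delta>) + birkhoff_sum T f (n i) (x i))))"
      using in_I by (intro emeasure_UN_le_infsum) (auto intro: sets)
    also have "\<dots> \<le> (\<Sum>\<^sub>\<infinity>i\<in>I. ennreal (exp (- real (n i) * (s - \<delta>) + birkhoff_sum T f (n i) (x i))))"
      by (intro infsum_mono_neutral nonneg_summable_on_complete) auto
    finally have "emeasure \<mu> (\<Union>i\<in>?J. ?B i) \<le> ennreal (1 / real (Suc k))"
      using small by simp
    moreover have "A \<subseteq> (\<Union>i\<in>?J. ?B i)"
      using cov A(1) by (fastforce simp: bowen_covers_def)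
    moreover have "(\<Union>i\<in>?J. ?B i) \<in> sets \<mu>"
      using in_I by (intro sets.countable_UN'') (auto intro: sets)
    ultimately show ?thesis by blast
  qed
  then obtain U where U: "\<And>k. U k \<in> sets \<mu>" "\<And>k. A \<subseteq> U k"
    "\<And>k. emeasure \<mu> (U k) \<le> ennreal (1 / real (Suc k))"
    by metis
  have "emeasure \<mu> (\<Inter>k. U k) \<le> ennreal (1 / real (Suc k))" for k
    using U(1) by (intro order_trans[OF emeasure_mono U(3)]) auto
  then have "measure \<mu> (\<Inter>k. U k) \<le> 1 / real (Suc k)" for k
    by (simp add: emeasure_eq_measure)
  then have "measure \<mu> (\<Inter>k. U k) \<le> 0"
    by (metis reals_Archimedean inverse_eq_divide not_le le_less_trans less_irrefl)
  then have "(\<Inter>k. U k) \<in> null_sets \<mu>"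
    using U(1) by (intro null_setsI) (auto simp: emeasure_eq_measure measure_le_0_iff)
  then show ?thesis
    by (rule AE_I') (use U(2) in auto)
qed

text \<open>The points of \<open>K\<close> with local pressure above \<open>s\<close> lie in
  countably many sets, indexed by a radius and an order from which on the quotient exceeds
  \<open>s\<close>. Each is null by the mass distribution principle, because the exponent
  \<open>t\<close> left after the variation loss still exceeds the Bowen pressure.\<close>

lemma AE_lower_local_pressure_le:
  assumes \<mu>: "\<mu> \<in> borel_prob_measures (X 0)" and K: "AE x in \<mu>. x \<in> K" "K \<subseteq> mspace (X 0)"
    and f: "equicontinuous X f"
    and "bowen_pressure X T f K < ereal s"
  shows "AE x in \<mu>. lower_local_pressure X T f \<mu> x \<le> ereal s"
proof -
  obtain t where t: "bowen_pressure X T f K < ereal t" "t < s"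
    using ereal_dense2[OF assms(5)] by auto
  obtain e where e: "0 < e" and var: "\<And>n x y. 0 < n \<Longrightarrow> x \<in> mspace (X 0) \<Longrightarrow> y \<in> bowen_ball X T n x e \<Longrightarrow>
      \<bar>birkhoff_sum T f n x - birkhoff_sum T f n y\<bar> \<le> real n * (s - t)"
    using birkhoff_sum_variation[OF f, of "s - t"] t(2) by auto
  let ?q = "\<lambda>\<epsilon> n x. (neg_log_measure \<mu> (bowen_ball X T n x \<epsilon>) + ereal (birkhoff_sum T f n x)) / ereal (real n)"
  \<comment> \<open>A sequence of radii tending to 0, so that only countably many exceptional sets
    occur, and bounded by \<open>e\<close>, so that the variation bound holds for all of
    them.\<close>
  define \<epsilon> where "\<epsilon> k = e / real (Suc k)" for k :: nat
  define A where "A k N = {x \<in> K. \<forall>n\<ge>N. ereal s < ?q (2 * \<epsilon> k) n x}" for k N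
  have \<epsilon>: "0 < \<epsilon> k" "\<epsilon> k \<le> e" for k
    using e by (auto simp: \<epsilon>_def field_simps)
  \<comment> \<open>Starting at \<open>Suc N\<close> keeps the orders positive.\<close>
  have "AE x in \<mu>. x \<notin> A k (Suc N)" for k N
  proof (rule AE_notin_if_bowen_sum_inf_eq_0[OF \<mu>, where \<epsilon> = "\<epsilon> k" and \<delta> = "s - t"])
    show "bowen_sum_inf X T f (s - (s - t)) (Suc N) (\<epsilon> k) K = 0"
    proof (rule ccontr)
      assume "bowen_sum_inf X T f (s - (s - t)) (Suc N) (\<epsilon> k) K \<noteq> 0"
      from le_bowen_pressure_atI[OF this] have "ereal t \<le> bowen_pressure_at X T f K (\<epsilon> k)" by simp
      also have "\<dots> \<le> bowen_pressure X T f K"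
        unfolding bowen_pressure_eq_SUP using \<epsilon> by (intro SUP_upper) auto
      finally show False using t(1) by simp
    qed
    show "\<bar>birkhoff_sum T f n x - birkhoff_sum T f n y\<bar> \<le> real n * (s - t)"
      if "0 < n" "x \<in> mspace (X 0)" "y \<in> bowen_ball X T n x (\<epsilon> k)" for n x y
      using that(3) bowen_ball_mono[OF \<epsilon>(2)] by (intro var that(1,2)) blast
  qed (use K(2) in \<open>auto simp: A_def\<close>)
  then have "AE x in \<mu>. \<forall>k N. x \<notin> A k (Suc N)"
    by (simp add: AE_all_countable)
  with K(1) show ?thesis
  proof eventually_elim
    case (elim x)
    show ?case
    proof (rule ccontr)
      assume "\<not> lower_local_pressure X T f \<mu> x \<le> ereal s"
      then have gt: "ereal s < lower_local_pressure X T f \<mu> x" by simp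
      have x0: "x \<in> mspace (X 0)" using elim(1) K(2) by auto
      obtain r where r: "0 < r" "ereal s < liminf (\<lambda>n. ?q r n x)"
        using gt unfolding lower_local_pressure_eq_SUP[OF \<mu> x0] less_SUP_iff by auto
      then obtain N where N: "\<And>n. N \<le> n \<Longrightarrow> ereal s < ?q r n x"
        using less_LiminfD[OF r(2)] by (auto simp: eventually_sequentially)
      \<comment> \<open>Passing from the radius \<open>r\<close> to the smaller
        \<open>2 * \<epsilon> k\<close> only increases the quotient.\<close>
      obtain k where k: "inverse (real (Suc k)) < r / (2 * e)"
        using reals_Archimedean[of "r / (2 * e)"] r(1) e by auto
      have "2 * \<epsilon> k \<le> r"
        using k e by (simp add: \<epsilon>_def field_simps)
      have "finite_measure \<mu>"
        using \<mu> by (auto simp: borel_prob_measures_def prob_space_def)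
      then have le: "?q r n x \<le> ?q (2 * \<epsilon> k) n x" if "Suc N \<le> n" for n
        using that \<open>2 * \<epsilon> k \<le> r\<close> elim K(2)
        by (intro ereal_divide_right_mono add_right_mono neg_log_measure_antimono bowen_ball_mono
            open_in_borel_prob_measures[OF \<mu>] openin_bowen_ball) auto
      have "ereal s < ?q (2 * \<epsilon> k) n x" if "Suc N \<le> n" for n
        by (rule less_le_trans[OF N[OF Suc_leD[OF that]] le[OF that]])
      then have "x \<in> A k (Suc N)"
        by (simp add: A_def elim(1))
      then show False using elim(2) by blast
    qed
  qed
qed

section \<open>Measures of large lower pressure\<close>

text \<open>The bound \<open>m\<close> guarantees a separated subset of largest cardinality. A point
  outside all its balls could be added, since Bowen balls are symmetric in centre and point.\<close>

lemma maximal_separated_finite_set: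
  assumes n: "0 < n" and r: "0 < r" and A: "A \<subseteq> mspace (X 0)"
    and card: "\<And>Y. finite Y \<Longrightarrow> Y \<subseteq> A \<Longrightarrow>
      (\<And>y y'. y \<in> Y \<Longrightarrow> y' \<in> Y \<Longrightarrow> y' \<in> bowen_ball X T n y r \<Longrightarrow> y = y') \<Longrightarrow> card Y \<le> m"
  obtains Y where "finite Y" "Y \<subseteq> A"
    "\<And>y y'. y \<in> Y \<Longrightarrow> y' \<in> Y \<Longrightarrow> y' \<in> bowen_ball X T n y r \<Longrightarrow> y = y'"
    "A \<subseteq> (\<Union>y\<in>Y. bowen_ball X T n y r)"
proof -
  define S where "S Y \<longleftrightarrow> finite Y \<and> Y \<subseteq> A \<and>
    (\<forall>y\<in>Y. \<forall>y'\<in>Y. y' \<in> bowen_ball X T n y r \<longrightarrow> y = y')" for Y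
  have "S {}" by (simp add: S_def)
  moreover have "\<forall>Y. S Y \<longrightarrow> card Y < Suc m"
    using card unfolding S_def by (simp add: less_Suc_eq_le)
  ultimately obtain Y where Y: "S Y" and max: "\<And>Y'. S Y' \<Longrightarrow> card Y' \<le> card Y"
    using ex_has_greatest_nat[of S "{}" card "Suc m"] by blast
  have "x \<in> (\<Union>y\<in>Y. bowen_ball X T n y r)" if x: "x \<in> A" for x
  proof (rule ccontr)
    assume no: "x \<notin> (\<Union>y\<in>Y. bowen_ball X T n y r)"
    have x0: "x \<in> mspace (X 0)" using x A by auto
    then have "mdist (X j) (iter T j x) (iter T j x) = 0" for j
      using mdist_zero[OF iter_in_mspace iter_in_mspace] by simp
    then have "x \<in> bowen_ball X T n x r"
      using n r x0 by (simp add: bowen_ball_iff)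
    then have "x \<notin> Y" using no by blast
    have no': "y \<notin> bowen_ball X T n x r" if "y \<in> Y" for y
      using no that bowen_ball_commute[OF n x0] by blast
    have "S (insert x Y)"
      using Y x no no' by (auto simp: S_def)
    then show False
      using max[of "insert x Y"] \<open>x \<notin> Y\<close> Y by (simp add: S_def)
  qed
  then have "A \<subseteq> (\<Union>y\<in>Y. bowen_ball X T n y r)" by (rule subsetI)
  with Y show thesis
    using that[of Y] by (simp add: S_def)
qed

text \<open>A ball of radius \<open>\<epsilon>\<close> contains at most one point of a \<open>2\<epsilon>\<close>-separated set, so summing
  over the separated set costs no more than the weights.\<close>

lemma separated_sum_le_weighted_sum:
  fixes c :: "'j \<Rightarrow> real" and b :: "'a \<Rightarrow> real"
  assumes n: "0 < n" and J: "finite J" "\<And>j. j \<in> J \<Longrightarrow> x j \<in> mspace (X 0)" "\<And>j. j \<in> J \<Longrightarrow> 0 \<le> c j"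
    and Y: "finite Y"
    and sep: "\<And>y y'. y \<in> Y \<Longrightarrow> y' \<in> Y \<Longrightarrow> y' \<in> bowen_ball X T n y (2 * \<epsilon>) \<Longrightarrow> y = y'"
    and w: "\<And>j. j \<in> J \<Longrightarrow> 0 \<le> w j"
    and b: "\<And>y j. y \<in> Y \<Longrightarrow> j \<in> J \<Longrightarrow> y \<in> bowen_ball X T n (x j) \<epsilon> \<Longrightarrow> b y \<le> w j"
    and le: "\<And>y. y \<in> Y \<Longrightarrow> t \<le> (\<Sum>j\<in>J. c j * indicator (bowen_ball X T n (x j) \<epsilon>) y)"
    and b0: "\<And>y. y \<in> Y \<Longrightarrow> 0 \<le> b y"
  shows "t * (\<Sum>y\<in>Y. b y) \<le> (\<Sum>j\<in>J. c j * w j)"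
proof -
  let ?B = "\<lambda>j. bowen_ball X T n (x j) \<epsilon>"
  have "t * (\<Sum>y\<in>Y. b y) \<le> (\<Sum>y\<in>Y. \<Sum>j\<in>J. c j * indicator (?B j) y * b y)"
    unfolding sum_distrib_left
  proof (rule sum_mono)
    fix y assume "y \<in> Y"
    then show "t * b y \<le> (\<Sum>j\<in>J. c j * indicator (?B j) y * b y)"
      unfolding sum_distrib_right[symmetric] by (intro mult_right_mono le b0)
  qed
  also have "\<dots> = (\<Sum>j\<in>J. \<Sum>y\<in>Y. c j * indicator (?B j) y * b y)"
    by (rule sum.swap)
  also have "\<dots> \<le> (\<Sum>j\<in>J. c j * w j)"
  proof (rule sum_mono)
    fix j assume j: "j \<in> J"
    have "y = y'" if "y \<in> Y \<inter> ?B j" "y' \<in> Y \<inter> ?B j" for y y'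
    proof (rule sep)
      have "y \<in> mspace (X 0)" using that(1) by (simp add: bowen_ball_def)
      then show "y' \<in> bowen_ball X T n y (2 * \<epsilon>)"
        using bowen_ball_trans[OF n _ bowen_ball_commute[OF n J(2)[OF j]], of y \<epsilon> y' \<epsilon>] that by simp
    qed (use that in auto)
    then have "card (Y \<inter> ?B j) \<le> 1"
      by (subst card_le_Suc0_iff_eq[unfolded One_nat_def[symmetric]]) (use Y in auto)
    have "(\<Sum>y\<in>Y. c j * indicator (?B j) y * b y) = (\<Sum>y\<in>Y \<inter> ?B j. c j * b y)"
      unfolding sum.inter_restrict[OF Y] by (intro sum.cong) auto
    also have "\<dots> \<le> (\<Sum>y\<in>Y \<inter> ?B j. c j * w j)"
      using j by (intro sum_mono mult_left_mono b J(3)) auto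
    also have "\<dots> = real (card (Y \<inter> ?B j)) * (c j * w j)" by simp
    also have "\<dots> \<le> 1 * (c j * w j)"
      using \<open>card (Y \<inter> ?B j) \<le> 1\<close> J(3)[OF j] w[OF j] by (intro mult_right_mono) auto
    finally show "(\<Sum>y\<in>Y. c j * indicator (?B j) y * b y) \<le> c j * w j" by simp
  qed
  finally show ?thesis .
qed

text \<open>Where the total weight is at least 1, the balls of some order \<open>n\<close> alone have weight at least
  \<open>exp (- n \<delta>)\<close>; that part of the set is covered by balls around a maximal separated subset.\<close>

lemma bowen_sum_inf_le_weighted_sum:
  fixes c :: "nat \<times> 'a \<Rightarrow> real"
  assumes N: "0 < N" and \<epsilon>: "0 < \<epsilon>" and K: "K \<subseteq> mspace (X 0)"
    and var: "\<And>n x y. 0 < n \<Longrightarrow> x \<in> mspace (X 0) \<Longrightarrow> y \<in> bowen_ball X T n x \<epsilon> \<Longrightarrow>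
      \<bar>birkhoff_sum T f n x - birkhoff_sum T f n y\<bar> \<le> real n * \<delta>"
    and tail: "\<And>F. finite F \<Longrightarrow> F \<subseteq> {N..} \<Longrightarrow> (\<Sum>n\<in>F. exp (- real n * \<delta>)) \<le> 1"
    and J: "finite J" "J \<subseteq> {N..} \<times> mspace (X 0)" and c: "\<And>j. j \<in> J \<Longrightarrow> 0 \<le> c j"
    and cover: "\<And>x. x \<in> K \<Longrightarrow> 1 \<le> (\<Sum>j\<in>J. c j * indicator (bowen_ball X T (fst j) (snd j) \<epsilon>) x)"
  shows "bowen_sum_inf X T f (s + 2 * \<delta>) N (2 * \<epsilon>) K
    \<le> ennreal (\<Sum>j\<in>J. c j * exp (- real (fst j) * s + birkhoff_sum T f (fst j) (snd j)))"
proof -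
  define Jn where "Jn n = {j \<in> J. fst j = n}" for n
  define F where "F = fst ` J"
  define g where "g n x = (\<Sum>j\<in>Jn n. c j * indicator (bowen_ball X T n (snd j) \<epsilon>) x)" for n x
  define Kn where "Kn n = {x \<in> K. exp (- real n * \<delta>) \<le> g n x}" for n
  have F: "finite F" "F \<subseteq> {N..}" using J by (auto simp: F_def)
  have Jn: "finite (Jn n)" "\<And>j. j \<in> Jn n \<Longrightarrow> snd j \<in> mspace (X 0)" "\<And>j. j \<in> Jn n \<Longrightarrow> 0 \<le> c j" for n
    using J c by (auto simp: Jn_def)
  have group: "(\<Sum>n\<in>F. \<Sum>j\<in>Jn n. h j) = (\<Sum>j\<in>J. h j)" for h :: "nat \<times> 'a \<Rightarrow> real"
    unfolding Jn_def by (rule sum.group) (use J F_def in auto)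
  have sum_g: "(\<Sum>n\<in>F. g n x) = (\<Sum>j\<in>J. c j * indicator (bowen_ball X T (fst j) (snd j) \<epsilon>) x)" for x
    unfolding g_def group[symmetric] by (intro sum.cong refl) (auto simp: Jn_def)
  have Kn: "K \<subseteq> (\<Union>n\<in>F. Kn n)"
  proof
    fix x assume x: "x \<in> K"
    \<comment> \<open>Pigeonhole over the orders: if each one stayed below its threshold, the total
      weight at \<open>x\<close> would be less than 1.\<close>
    have "\<exists>n\<in>F. exp (- real n * \<delta>) \<le> g n x"
    proof (rule ccontr)
      assume "\<not> (\<exists>n\<in>F. exp (- real n * \<delta>) \<le> g n x)"
      then have lt: "\<And>n. n \<in> F \<Longrightarrow> g n x < exp (- real n * \<delta>)" by auto
      have "F \<noteq> {}" using cover[OF x] sum_g[of x] by auto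
      then have "(\<Sum>n\<in>F. g n x) < (\<Sum>n\<in>F. exp (- real n * \<delta>))"
        by (intro sum_strict_mono F lt)
      then show False
        using cover[OF x] sum_g[of x] tail[OF F] by simp
    qed
    then show "x \<in> (\<Union>n\<in>F. Kn n)" using x by (auto simp: Kn_def)
  qed
  define Q where "Q n Y \<longleftrightarrow> finite Y \<and> Y \<subseteq> Kn n \<and> Kn n \<subseteq> (\<Union>y\<in>Y. bowen_ball X T n y (2 * \<epsilon>)) \<and>
     (\<Sum>y\<in>Y. exp (- real n * (s + 2 * \<delta>) + birkhoff_sum T f n y))
      \<le> (\<Sum>j\<in>Jn n. c j * exp (- real n * s + birkhoff_sum T f n (snd j)))" for n Y
  have "\<exists>Y. Q n Y" if n: "n \<in> F" for n
  proof -
    have n0: "0 < n" using n F N by auto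
    have Kn0: "Kn n \<subseteq> mspace (X 0)" using K by (auto simp: Kn_def)
    have sum_le: "exp (- real n * \<delta>) * (\<Sum>y\<in>Y. b y) \<le> (\<Sum>j\<in>Jn n. c j * w j)"
      if "finite Y" "Y \<subseteq> Kn n"
        "\<And>y y'. y \<in> Y \<Longrightarrow> y' \<in> Y \<Longrightarrow> y' \<in> bowen_ball X T n y (2 * \<epsilon>) \<Longrightarrow> y = y'"
        "\<And>j. 0 \<le> w j" "\<And>y. 0 \<le> b y"
        "\<And>y j. j \<in> Jn n \<Longrightarrow> y \<in> bowen_ball X T n (snd j) \<epsilon> \<Longrightarrow> b y \<le> w j"
      for Y and b :: "'a \<Rightarrow> real" and w :: "nat \<times> 'a \<Rightarrow> real"
      by (rule separated_sum_le_weighted_sum[OF n0 Jn(1), where x = snd and \<epsilon> = \<epsilon>])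
        (use that Jn Kn_def g_def in auto)
    \<comment> \<open>Taking \<open>b\<close> and \<open>w\<close> constantly 1 bounds the size of
      separated sets, so that a maximal one exists.\<close>
    have "card Y \<le> nat \<lfloor>exp (real n * \<delta>) * (\<Sum>j\<in>Jn n. c j)\<rfloor>"
      if "finite Y" "Y \<subseteq> Kn n"
        "\<And>y y'. y \<in> Y \<Longrightarrow> y' \<in> Y \<Longrightarrow> y' \<in> bowen_ball X T n y (2 * \<epsilon>) \<Longrightarrow> y = y'" for Y
    proof -
      have "exp (- real n * \<delta>) * real (card Y) \<le> (\<Sum>j\<in>Jn n. c j)"
        using sum_le[OF that, of "\<lambda>_. 1" "\<lambda>_. 1"] by simp
      then have "real (card Y) \<le> exp (real n * \<delta>) * (\<Sum>j\<in>Jn n. c j)"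
        by (simp add: exp_minus field_simps)
      then show ?thesis by (simp add: le_nat_floor)
    qed
    then obtain Y where Y: "finite Y" "Y \<subseteq> Kn n"
        "\<And>y y'. y \<in> Y \<Longrightarrow> y' \<in> Y \<Longrightarrow> y' \<in> bowen_ball X T n y (2 * \<epsilon>) \<Longrightarrow> y = y'"
        "Kn n \<subseteq> (\<Union>y\<in>Y. bowen_ball X T n y (2 * \<epsilon>))"
      using maximal_separated_finite_set[OF n0 _ Kn0, of "2 * \<epsilon>"] \<epsilon> by (metis mult_pos_pos zero_less_numeral)
    \<comment> \<open>The exponent loss \<open>2 * \<delta>\<close> has two halves: one is the
      threshold \<open>exp (- real n * \<delta>)\<close> in \<open>Kn\<close>, the other pays for
      moving the Birkhoff sum from \<open>y\<close> to the centre of a weighted ball.\<close>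
    have "(\<Sum>y\<in>Y. exp (- real n * (s + 2 * \<delta>) + birkhoff_sum T f n y))
        = exp (- real n * \<delta>) * (\<Sum>y\<in>Y. exp (- real n * (s + \<delta>) + birkhoff_sum T f n y))"
      by (simp add: sum_distrib_left algebra_simps flip: exp_add)
    also have "\<dots> \<le> (\<Sum>j\<in>Jn n. c j * exp (- real n * s + birkhoff_sum T f n (snd j)))"
    proof (rule sum_le[OF Y(1-3)])
      fix y j assume "j \<in> Jn n" "y \<in> bowen_ball X T n (snd j) \<epsilon>"
      from var[OF n0 Jn(2)[OF this(1)] this(2)]
      show "exp (- real n * (s + \<delta>) + birkhoff_sum T f n y) \<le> exp (- real n * s + birkhoff_sum T f n (snd j))"
        by (simp add: algebra_simps)
    qed auto
    finally have "Q n Y" unfolding Q_def using Y(1,2,4) by (intro conjI)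
    then show ?thesis ..
  qed
  then obtain Y where Q: "\<And>n. n \<in> F \<Longrightarrow> Q n (Y n)"
    by metis
  have Y: "\<And>n. n \<in> F \<Longrightarrow> finite (Y n)" "\<And>n. n \<in> F \<Longrightarrow> Y n \<subseteq> Kn n"
     "\<And>n. n \<in> F \<Longrightarrow> Kn n \<subseteq> (\<Union>y\<in>Y n. bowen_ball X T n y (2 * \<epsilon>))"
     "\<And>n. n \<in> F \<Longrightarrow> (\<Sum>y\<in>Y n. exp (- real n * (s + 2 * \<delta>) + birkhoff_sum T f n y))
      \<le> (\<Sum>j\<in>Jn n. c j * exp (- real n * s + birkhoff_sum T f n (snd j)))"
    using Q unfolding Q_def by simp_all
  have "bowen_sum_inf X T f (s + 2 * \<delta>) N (2 * \<epsilon>) K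
    \<le> ennreal (\<Sum>(n, y)\<in>Sigma F Y. exp (- real n * (s + 2 * \<delta>) + birkhoff_sum T f n y))"
  proof (rule bowen_sum_inf_le_finite_cover)
    show "finite (Sigma F Y)" using F Y(1) by auto
    show "Sigma F Y \<subseteq> {N..} \<times> mspace (X 0)"
    proof
      fix p assume "p \<in> Sigma F Y"
      then have "fst p \<in> F" "snd p \<in> Kn (fst p)" using Y(2)[of "fst p"] by auto
      then show "p \<in> {N..} \<times> mspace (X 0)"
        using F(2) K by (auto simp: Kn_def mem_Times_iff)
    qed
    show "K \<subseteq> (\<Union>(n, y)\<in>Sigma F Y. bowen_ball X T n y (2 * \<epsilon>))"
    proof
      fix x assume "x \<in> K"
      then obtain n where "n \<in> F" "x \<in> Kn n" using Kn by auto
      with Y(3)[of n] obtain y where "y \<in> Y n" "x \<in> bowen_ball X T n y (2 * \<epsilon>)" by blast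
      with \<open>n \<in> F\<close> show "x \<in> (\<Union>(n, y)\<in>Sigma F Y. bowen_ball X T n y (2 * \<epsilon>))"
        by (intro UN_I[of "(n, y)"]) auto
    qed
  qed
  also have "(\<Sum>(n, y)\<in>Sigma F Y. exp (- real n * (s + 2 * \<delta>) + birkhoff_sum T f n y))
      = (\<Sum>n\<in>F. \<Sum>y\<in>Y n. exp (- real n * (s + 2 * \<delta>) + birkhoff_sum T f n y))"
    using F Y(1) by (subst sum.Sigma) auto
  also have "\<dots> \<le> (\<Sum>n\<in>F. \<Sum>j\<in>Jn n. c j * exp (- real n * s + birkhoff_sum T f n (snd j)))"
    by (intro sum_mono Y(4))
  also have "\<dots> = (\<Sum>j\<in>J. c j * exp (- real (fst j) * s + birkhoff_sum T f (fst j) (snd j)))"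
    unfolding group[symmetric] by (intro sum.cong refl) (auto simp: Jn_def)
  finally show ?thesis by (simp add: ennreal_leI)
qed

text \<open>A Frostman lemma: by minimax duality, a charge with small mass on all balls exists unless some
  weighted cover of \<open>K\<close> is cheap.\<close>

lemma frostman_measure:
  assumes K: "K \<noteq> {}" "compactin (mtopology_of (X 0)) K"
    and f: "equicontinuous X f" and s: "ereal s < bowen_pressure X T f K"
  obtains \<mu> \<epsilon> \<eta> N where "\<mu> \<in> borel_prob_measures (X 0)" "measure \<mu> K = 1" "0 < \<epsilon>" "0 < \<eta>"
    "\<And>n x. N \<le> n \<Longrightarrow> x \<in> mspace (X 0) \<Longrightarrow>
      measure \<mu> (bowen_ball X T n x \<epsilon>) \<le> exp (- real n * s + birkhoff_sum T f n x) / \<eta>"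
proof -
  have K0: "K \<subseteq> mspace (X 0)" using compactin_subset_topspace[OF K(2)] by simp
  have Haus: "Hausdorff_space (mtopology_of (X 0))"
    using Metric_space.Hausdorff_space_mtopology[OF Metric_space_mspace_mdist]
    by (simp add: mtopology_of_def)
  obtain t where t: "ereal t < bowen_pressure X T f K" "s < t"
    using ereal_dense2[OF s] by auto
  \<comment> \<open>Half of the gap, because passing from weighted covers to covers loses
    \<open>2 * \<delta>\<close>.\<close>
  define \<delta> where "\<delta> = (t - s) / 2"
  have \<delta>: "0 < \<delta>" "t = s + 2 * \<delta>" using t(2) by (auto simp: \<delta>_def field_simps)
  obtain e where e: "0 < e" and var: "\<And>n x y. 0 < n \<Longrightarrow> x \<in> mspace (X 0) \<Longrightarrow> y \<in> bowen_ball X T n x e \<Longrightarrow>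
      \<bar>birkhoff_sum T f n x - birkhoff_sum T f n y\<bar> \<le> real n * \<delta>"
    using birkhoff_sum_variation[OF f \<delta>(1)] by auto
  obtain e' where e': "0 < e'" "ereal t < bowen_pressure_at X T f K e'"
    using t(1) unfolding bowen_pressure_eq_SUP less_SUP_iff by auto
  \<comment> \<open>The variation bound requires radius at most \<open>e\<close>; the doubled radius
    must stay below \<open>e'\<close>, where the pressure still exceeds \<open>t\<close>.\<close>
  define \<epsilon> where "\<epsilon> = min e (e' / 2)"
  have \<epsilon>: "0 < \<epsilon>" "\<epsilon> \<le> e" "2 * \<epsilon> \<le> e'" using e e'(1) by (auto simp: \<epsilon>_def)
  have "bowen_sum_lim X T f t e' K \<noteq> 0"
  proof
    assume "bowen_sum_lim X T f t e' K = 0"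
    then have "bowen_pressure_at X T f K e' \<le> ereal t"
      unfolding bowen_pressure_at_def by (intro Inf_lower) auto
    then show False using e'(2) by simp
  qed
  then obtain N0 where N0: "bowen_sum_inf X T f t N0 e' K \<noteq> 0"
    unfolding bowen_sum_lim_eq_0_iff by auto
  obtain M where M: "\<And>F. finite F \<Longrightarrow> F \<subseteq> {M..} \<Longrightarrow> (\<Sum>n\<in>F. exp (- real n * \<delta>)) \<le> 1"
    using exp_sum_tail_le_1[OF \<delta>(1)] by blast
  \<comment> \<open>Beyond \<open>N0\<close> the Bowen sum stays nonzero, beyond \<open>M\<close>
    the thresholds add up to at most 1, and orders must be positive.\<close>
  define N where "N = max (max N0 M) 1"
  have N: "0 < N" "N0 \<le> N" "M \<le> N" by (auto simp: N_def)
  have "bowen_sum_inf X T f t N0 e' K \<le> bowen_sum_inf X T f t N (2 * \<epsilon>) K"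
    using bowen_sum_inf_mono[OF N(2)] bowen_sum_inf_antimono_radius[OF \<epsilon>(3)] order_trans by blast
  then have "0 < bowen_sum_inf X T f t N (2 * \<epsilon>) K"
    using N0 by (metis gr_zeroI le_zero_eq)
  \<comment> \<open>The Bowen sum may be infinite; density provides a finite positive number below
    it.\<close>
  then obtain \<eta>' where \<eta>': "0 < \<eta>'" "\<eta>' < bowen_sum_inf X T f t N (2 * \<epsilon>) K"
    using dense by blast
  define \<eta> where "\<eta> = enn2real \<eta>'"
  have "\<eta>' \<noteq> top" using \<eta>'(2) by auto
  then have \<eta>: "0 < \<eta>" "ennreal \<eta> < bowen_sum_inf X T f t N (2 * \<epsilon>) K"
    using \<eta>' by (auto simp: \<eta>_def enn2real_positive_iff less_top)
  let ?J = "{N..} \<times> mspace (X 0)" and ?B = "\<lambda>j. bowen_ball X T (fst j) (snd j) \<epsilon>"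
  let ?r = "\<lambda>j. exp (- real (fst j) * s + birkhoff_sum T f (fst j) (snd j)) / \<eta>"
  have "\<exists>m\<in>prob_charges K. \<forall>j\<in>?J. m (?B j) \<le> ?r j"
  proof (rule prob_charge_minimax[OF _ K(1)])
    show "0 \<le> ?r j" for j using \<eta>(1) by simp
    fix I c assume I: "finite I" "I \<subseteq> ?J" and c: "\<And>j. j \<in> I \<Longrightarrow> 0 \<le> (c j :: real)"
      and cover: "\<And>x. x \<in> K \<Longrightarrow> 1 \<le> (\<Sum>j\<in>I. c j * indicator (?B j) x)"
    \<comment> \<open>Every finite weighted cover costs at least as much as the Bowen sum, hence
      more than \<open>\<eta>\<close>; division by \<open>\<eta>\<close> gives the bound 1 required
      by the duality.\<close>
    have "bowen_sum_inf X T f (s + 2 * \<delta>) N (2 * \<epsilon>) K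
        \<le> ennreal (\<Sum>j\<in>I. c j * exp (- real (fst j) * s + birkhoff_sum T f (fst j) (snd j)))"
    proof (rule bowen_sum_inf_le_weighted_sum[OF N(1) \<epsilon>(1) K0 _ _ I c cover])
      show "\<bar>birkhoff_sum T f n x - birkhoff_sum T f n y\<bar> \<le> real n * \<delta>"
        if "0 < n" "x \<in> mspace (X 0)" "y \<in> bowen_ball X T n x \<epsilon>" for n x y
        using that(3) bowen_ball_mono[OF \<epsilon>(2)] by (intro var that(1,2)) blast
      show "(\<Sum>n\<in>F. exp (- real n * \<delta>)) \<le> 1" if "finite F" "F \<subseteq> {N..}" for F
        using that N(3) by (intro M) auto
    qed
    with \<eta>(2) have "ennreal \<eta> < ennreal (\<Sum>j\<in>I. c j * exp (- real (fst j) * s + birkhoff_sum T f (fst j) (snd j)))"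
      unfolding \<delta>(2) by (rule less_le_trans)
    then have "\<eta> < (\<Sum>j\<in>I. c j * exp (- real (fst j) * s + birkhoff_sum T f (fst j) (snd j)))"
      using \<eta>(1) by (subst (asm) ennreal_less_iff) auto
    then show "1 \<le> (\<Sum>j\<in>I. c j * ?r j)"
      using \<eta>(1) by (simp add: sum_divide_distrib[symmetric])
  qed
  then obtain m where m: "m \<in> prob_charges K" and m_le: "\<And>j. j \<in> ?J \<Longrightarrow> m (?B j) \<le> ?r j"
    by blast
  obtain \<mu> where \<mu>: "prob_space \<mu>" "space \<mu> = mspace (X 0)"
      "sets \<mu> = sigma_sets (mspace (X 0)) {U. openin (mtopology_of (X 0)) U}"
    and \<mu>_le: "\<And>U. openin (mtopology_of (X 0)) U \<Longrightarrow> measure \<mu> U \<le> m U"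
    using prob_charge_regularisation[OF m _ compact_spaces Haus] K0 by auto
  have bpm: "\<mu> \<in> borel_prob_measures (X 0)"
    using \<mu> by (simp add: borel_prob_measures_def)
  interpret prob_space \<mu> by fact
  have closed: "closedin (mtopology_of (X 0)) K"
    by (rule compactin_imp_closedin[OF Haus K(2)])
  \<comment> \<open>Regularisation bounds only open sets, and only from above, so concentration on
    \<open>K\<close> is read off from its open complement.\<close>
  have "measure \<mu> (space \<mu> - K) \<le> m (mspace (X 0) - K)"
    using closed unfolding \<mu>(2) by (intro \<mu>_le) (simp add: closedin_def)
  also have "\<dots> \<le> m (- K)"
    by (intro prob_charges_mono[OF m]) auto
  also have "\<dots> = 0"
    using m by (simp add: prob_charges_def)
  finally have "measure \<mu> K = 1"
    using prob_compl[OF closed_in_borel_prob_measures[OF bpm closed]] prob_le_1[of K] by simp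
  moreover have "measure \<mu> (bowen_ball X T n x \<epsilon>) \<le> exp (- real n * s + birkhoff_sum T f n x) / \<eta>"
    if "N \<le> n" "x \<in> mspace (X 0)" for n x
    using \<mu>_le[OF openin_bowen_ball, of n x \<epsilon>] m_le[of "(n, x)"] that N(1) by simp
  ultimately show thesis
    by (intro that[OF bpm _ \<epsilon>(1) \<eta>(1)])
qed

text \<open>The constant factor contributes \<open>ln \<eta> / real n\<close>, which tends to 0. A
  single radius suffices because the local pressure is a supremum over radii.\<close>

lemma le_lower_local_pressure_if_measure_bowen_ball_le:
  assumes \<mu>: "\<mu> \<in> borel_prob_measures (X 0)" and x: "x \<in> mspace (X 0)" and pos: "0 < \<epsilon>" "0 < \<eta>"
    and le: "\<And>n. N \<le> n \<Longrightarrow>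
      measure \<mu> (bowen_ball X T n x \<epsilon>) \<le> exp (- real n * s + birkhoff_sum T f n x) / \<eta>"
  shows "ereal s \<le> lower_local_pressure X T f \<mu> x"
proof -
  let ?q = "\<lambda>n. (neg_log_measure \<mu> (bowen_ball X T n x \<epsilon>) + ereal (birkhoff_sum T f n x)) / ereal (real n)"
  have "(\<lambda>n. s + ln \<eta> / real n) \<longlonglongrightarrow> s + 0"
    by (intro tendsto_intros lim_const_over_n)
  then have "ereal s = liminf (\<lambda>n. ereal (s + ln \<eta> / real n))"
    by (intro lim_imp_Liminf[symmetric]) auto
  also have "liminf (\<lambda>n. ereal (s + ln \<eta> / real n)) \<le> liminf ?q"
  proof (intro Liminf_mono eventually_sequentiallyI[of "Suc N"])
    fix n assume n: "Suc N \<le> n"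
    let ?m = "measure \<mu> (bowen_ball X T n x \<epsilon>)"
    show "ereal (s + ln \<eta> / real n) \<le> ?q n"
    proof (cases "?m = 0")
      case True
      then show ?thesis using n by (simp add: neg_log_measure_def)
    next
      case False
      then have "0 < ?m" by (simp add: zero_less_measure_iff)
      then have "ln ?m \<le> ln (exp (- real n * s + birkhoff_sum T f n x) / \<eta>)"
        using le[of n] n by (intro ln_mono) auto
      also have "\<dots> = - real n * s + birkhoff_sum T f n x - ln \<eta>"
        using pos by (simp add: ln_div)
      finally have "(real n * s + ln \<eta>) / real n \<le> (- ln ?m + birkhoff_sum T f n x) / real n"
        by (intro divide_right_mono) auto
      then have "s + ln \<eta> / real n \<le> (- ln ?m + birkhoff_sum T f n x) / real n"
        using n by (simp add: add_divide_distrib)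
      then show ?thesis using n False by (simp add: neg_log_measure_def)
    qed
  qed
  also have "liminf ?q \<le> lower_local_pressure X T f \<mu> x"
    unfolding lower_local_pressure_eq_SUP[OF \<mu> x] using pos by (intro SUP_upper) auto
  finally show ?thesis .
qed

end

section \<open>The variational principle for compact sets\<close>

theorem theorem2p6:
  fixes X :: "nat \<Rightarrow> 'a metric"
    and T :: "nat \<Rightarrow> 'a \<Rightarrow> 'a"
    and f :: "nat \<Rightarrow> 'a \<Rightarrow> real"
    and K :: "'a set"
  assumes "nds X T"
    and "K \<noteq> {}"
    and "compactin (mtopology_of (X 0)) K"
    and "f \<in> continuous_functions X"
    and "equicontinuous X f"
  shows "bowen_pressure X T f K =
    (SUP \<mu>\<in>{\<mu> \<in> borel_prob_measures (X 0). measure \<mu> K = 1}. lower_pressure X T f \<mu>)"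
proof (rule antisym)
  interpret nds X T by fact
  let ?M = "{\<mu> \<in> borel_prob_measures (X 0). measure \<mu> K = 1}"
  show "bowen_pressure X T f K \<le> (SUP \<mu>\<in>?M. lower_pressure X T f \<mu>)"
  proof (rule ccontr)
    assume "\<not> ?thesis"
    then have "(SUP \<mu>\<in>?M. lower_pressure X T f \<mu>) < bowen_pressure X T f K"
      by (simp only: not_le)
    from ereal_dense2[OF this] obtain s where
      s: "(SUP \<mu>\<in>?M. lower_pressure X T f \<mu>) < ereal s" "ereal s < bowen_pressure X T f K"
      by auto
    obtain \<mu> \<epsilon> \<eta> N where \<mu>: "\<mu> \<in> borel_prob_measures (X 0)" "measure \<mu> K = 1" "0 < \<epsilon>" "0 < \<eta>"
      "\<And>n x. N \<le> n \<Longrightarrow> x \<in> mspace (X 0) \<Longrightarrow>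
        measure \<mu> (bowen_ball X T n x \<epsilon>) \<le> exp (- real n * s + birkhoff_sum T f n x) / \<eta>"
      by (rule frostman_measure[OF assms(2,3,5) s(2)]) (rule that; simp)
    \<comment> \<open>The bound on balls holds for centres anywhere in the space, so the integrand
      is at least \<open>s\<close> everywhere and not only on \<open>K\<close>.\<close>
    have "ereal s \<le> lower_local_pressure X T f \<mu> x" if "x \<in> space \<mu>" for x
      using that \<mu>(1)
      by (intro le_lower_local_pressure_if_measure_bowen_ball_le[OF \<mu>(1) _ \<mu>(3,4)] \<mu>(5))
        (auto simp: borel_prob_measures_def)
    then have "ereal s \<le> lower_pressure X T f \<mu>"
      using \<mu>(1) unfolding lower_pressure_def
      by (intro ereal_integral_ge AE_I2) (auto simp: borel_prob_measures_def)
    also have "\<dots> \<le> (SUP \<mu>\<in>?M. lower_pressure X T f \<mu>)"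
      using \<mu>(1,2) by (intro SUP_upper) auto
    finally show False using s(1) by simp
  qed
  show "(SUP \<mu>\<in>?M. lower_pressure X T f \<mu>) \<le> bowen_pressure X T f K"
  proof (rule SUP_least, rule ccontr)
    fix \<mu> assume \<mu>: "\<mu> \<in> ?M" and "\<not> lower_pressure X T f \<mu> \<le> bowen_pressure X T f K"
    then have "bowen_pressure X T f K < lower_pressure X T f \<mu>"
      by (simp only: not_le)
    from ereal_dense2[OF this] obtain s where
      s: "bowen_pressure X T f K < ereal s" "ereal s < lower_pressure X T f \<mu>"
      by auto
    interpret prob_space \<mu> using \<mu> by (simp add: borel_prob_measures_def)
    have "AE x in \<mu>. x \<in> K"
      using \<mu> by (intro AE_prob_1) simp
    then have "AE x in \<mu>. lower_local_pressure X T f \<mu> x \<le> ereal s"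
      using \<mu> compactin_subset_topspace[OF assms(3)] s(1)
      by (intro AE_lower_local_pressure_le[OF _ _ _ assms(5)]) auto
    then have "lower_pressure X T f \<mu> \<le> ereal s"
      unfolding lower_pressure_def by (rule ereal_integral_le[OF prob_space_axioms])
    then show False using s(2) by simp
  qed
qed

end
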